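(* Every $q$-matroid $\mathcal{M}=(E,\rho)$ is a direct sum of irreducible $q$-matroids, and the summands are unique up to equivalence: if $\mathcal{M}\approx\mathcal{M}_1\oplus\cdots\oplus\mathcal{M}_t$ and $\mathcal{M}\approx\mathcal{N}_1\oplus\cdots\oplus\mathcal{N}_s$ with all $\mathcal{M}_i,\mathcal{N}_j$ irreducible, then $s=t$ and, after reordering, $\mathcal{M}_i\approx\mathcal{N}_i$ for all $i$.
   Context: Let $\mathbb{F}=\mathbb{F}_q$. A $q$-matroid is $\mathcal{M}=(E,\rho)$, $E$ a finite-dimensional $\mathbb{F}$-vector space, $\rho$ defined on subspaces with $0\le\rho(V)\le\dim V$, monotone and submodular ($\rho(V+W)+\rho(V\cap W)\le\rho(V)+\rho(W)$). Two $q$-matroids $(E_1,\rho_1),(E_2,\rho_2)$ are equivalent ($\approx$) if there is an $\mathbb{F}$-isomorphism $\alpha:E_1\to E_2$ with $\rho_2(\alpha(V))=\rho_1(V)$ for all subspaces $V$. Direct sum: for $q$-matroids $\mathcal{M}_i=(E_i,\rho_i)$ and $E=E_1\oplus E_2$ with projections $\pi_i:E\to E_i$, $\mathcal{M}_1\oplus\mathcal{M}_2=(E,\rho)$ where $\rho(V)=\dim V+\min_{X\le V}(\rho_1(\pi_1(X))+\rho_2(\pi_2(X))-\dim X)$; this operation is associative, so iterated direct sums $\mathcal{M}_1\oplus\cdots\oplus\mathcal{M}_t$ are well defined. We write $\mathcal{M}=\mathcal{M}_1\oplus\mathcal{M}_2$ when $E$ is the internal direct sum of $E_1,E_2$ and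 the rank functions agree. A $q$-matroid is reducible if $\mathcal{M}=\mathcal{M}_1\oplus\mathcal{M}_2$ with both ground spaces nonzero, and irreducible otherwise.
   Formalization: Uniqueness is proved for irreducible summands with nonzero ground space, because the zero q-matroid counts as irreducible and M ≈ M ⊕ 0 would break s = t; ground spaces are taken, up to isomorphism, as finite-dimensional subspaces of the space of sequences over F. *)

theory Defs
  imports Main "HOL.Vector_Spaces" "HOL-Library.Function_Algebras"
begin

text \<open>Ambient universe: the F-vector space nat => F (F a finite field, F = F_q).
  Ground spaces of q-matroids are finite-dimensional subspaces of it; every
  finite-dimensional F-space is isomorphic to such a subspace.\<close>

definition fscale :: "'f::field \<Rightarrow> (nat \<Rightarrow> 'f) \<Rightarrow> (nat \<Rightarrow> 'f)" where
  "fscale c v = (\<lambda>i. c * v i)"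

global_interpretation fv: Vector_Spaces.vector_space "fscale :: 'f::field \<Rightarrow> (nat \<Rightarrow> 'f) \<Rightarrow> (nat \<Rightarrow> 'f)"
  by unfold_locales (auto simp: fscale_def fun_eq_iff algebra_simps)

type_synonym 'f qm = "(nat \<Rightarrow> 'f) set \<times> ((nat \<Rightarrow> 'f) set \<Rightarrow> nat)"

definition subspaces :: "(nat \<Rightarrow> 'f::field) set \<Rightarrow> (nat \<Rightarrow> 'f) set set" where
  "subspaces E = {V. fv.subspace V \<and> V \<subseteq> E}"

definition qmatroid :: "'f::field qm \<Rightarrow> bool" where
  "qmatroid M \<longleftrightarrow> (case M of (E, \<rho>) \<Rightarrow>
     (\<exists>B. finite B \<and> fv.span B = E) \<and>
     (\<forall>V\<in>subspaces E. \<rho> V \<le> fv.dim V) \<and>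
     (\<forall>V\<in>subspaces E. \<forall>W\<in>subspaces E. V \<subseteq> W \<longrightarrow> \<rho> V \<le> \<rho> W) \<and>
     (\<forall>V\<in>subspaces E. \<forall>W\<in>subspaces E.
        \<rho> (fv.span (V \<union> W)) + \<rho> (V \<inter> W) \<le> \<rho> V + \<rho> W))"

definition qm_equiv :: "'f::field qm \<Rightarrow> 'f qm \<Rightarrow> bool" where
  "qm_equiv M N \<longleftrightarrow> (case M of (E1, \<rho>1) \<Rightarrow> case N of (E2, \<rho>2) \<Rightarrow>
     (\<exists>\<alpha>. bij_betw \<alpha> E1 E2 \<and>
        (\<forall>x\<in>E1. \<forall>y\<in>E1. \<alpha> (x + y) = \<alpha> x + \<alpha> y) \<and>
        (\<forall>c. \<forall>x\<in>E1. \<alpha> (fscale c x) = fscale c (\<alpha> x)) \<and>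
        (\<forall>V\<in>subspaces E1. \<rho>2 (\<alpha> ` V) = \<rho>1 V)))"

definition ds_rank ::
  "((nat \<Rightarrow> 'f::field) \<Rightarrow> (nat \<Rightarrow> 'f)) \<Rightarrow> ((nat \<Rightarrow> 'f) \<Rightarrow> (nat \<Rightarrow> 'f)) \<Rightarrow>
   ((nat \<Rightarrow> 'f) set \<Rightarrow> nat) \<Rightarrow> ((nat \<Rightarrow> 'f) set \<Rightarrow> nat) \<Rightarrow> (nat \<Rightarrow> 'f) set \<Rightarrow> nat" where
  "ds_rank p1 p2 \<rho>1 \<rho>2 V = nat (int (fv.dim V) +
     Min {int (\<rho>1 (p1 ` X)) + int (\<rho>2 (p2 ` X)) - int (fv.dim X) | X. X \<in> subspaces V})"

text \<open>External direct sum, realised inside the universe by interleaving coordinates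
  (E1 (+) E2 is identified with {interleave u v}); projections take even/odd coordinates.\<close>
definition interleave :: "(nat \<Rightarrow> 'f) \<Rightarrow> (nat \<Rightarrow> 'f) \<Rightarrow> (nat \<Rightarrow> 'f)" where
  "interleave u v = (\<lambda>i. if even i then u (i div 2) else v (i div 2))"

definition evp :: "(nat \<Rightarrow> 'f) \<Rightarrow> (nat \<Rightarrow> 'f)" where "evp w = (\<lambda>i. w (2 * i))"
definition odp :: "(nat \<Rightarrow> 'f) \<Rightarrow> (nat \<Rightarrow> 'f)" where "odp w = (\<lambda>i. w (2 * i + 1))"

definition dsum :: "'f::field qm \<Rightarrow> 'f qm \<Rightarrow> 'f qm" where
  "dsum M N = (case M of (E1, \<rho>1) \<Rightarrow> case N of (E2, \<rho>2) \<Rightarrow>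
     ({interleave u v | u v. u \<in> E1 \<and> v \<in> E2}, ds_rank evp odp \<rho>1 \<rho>2))"

text \<open>Iterated direct sum M1 (+) (M2 (+) ( ... (+) Mt)) (associativity makes bracketing irrelevant).\<close>
fun dsum_list :: "'f::field qm list \<Rightarrow> 'f qm" where
  "dsum_list [] = ({0}, \<lambda>_. 0)"
| "dsum_list [M] = M"
| "dsum_list (M # Ms) = dsum M (dsum_list Ms)"

definition iproj :: "(nat \<Rightarrow> 'f::field) set \<Rightarrow> (nat \<Rightarrow> 'f) set \<Rightarrow> (nat \<Rightarrow> 'f) \<Rightarrow> (nat \<Rightarrow> 'f)" where
  "iproj E1 E2 w = (THE u. u \<in> E1 \<and> w - u \<in> E2)"

definition reducible :: "'f::field qm \<Rightarrow> bool" where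
  "reducible M \<longleftrightarrow> (case M of (E, \<rho>) \<Rightarrow>
     (\<exists>E1 \<rho>1 E2 \<rho>2. qmatroid (E1, \<rho>1) \<and> qmatroid (E2, \<rho>2) \<and>
        E1 \<noteq> {0} \<and> E2 \<noteq> {0} \<and> E1 \<subseteq> E \<and> E2 \<subseteq> E \<and>
        E1 \<inter> E2 = {0} \<and> fv.span (E1 \<union> E2) = E \<and>
        (\<forall>V\<in>subspaces E. \<rho> V = ds_rank (iproj E1 E2) (iproj E2 E1) \<rho>1 \<rho>2 V)))"

definition irreducible_qm :: "'f::field qm \<Rightarrow> bool" where
  "irreducible_qm M \<longleftrightarrow> qmatroid M \<and> \<not> reducible M"

end

theory Submission
  imports Defs
begin

text \<open>Call a space cyclic if all its proper subspaces have smaller nullity \<open>dim - \<rho>\<close>. Every space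
  contains a cyclic space of the same nullity, so a q-matroid is determined by the ranks of its
  cyclic spaces; there a direct sum decomposition with projections \<open>p\<^sub>i\<close> simply says
  \<open>\<rho> X = \<Sum>\<^sub>i \<rho> (p\<^sub>i X)\<close>, and projections map cyclic spaces to cyclic spaces.
  For two decompositions \<open>p\<^sub>i\<close>, \<open>r\<^sub>j\<close> into irreducibles, a summand \<open>E\<^sub>i\<close> is a single loop, a single
  coloop, or cyclic and loop-free. In the last case submodularity forces \<open>p\<^sub>k r\<^sub>j E\<^sub>i\<close> to consist of loops
  for \<open>k \<noteq> i\<close>, so the maps \<open>p\<^sub>i r\<^sub>j\<close> restrict to a decomposition of \<open>E\<^sub>i\<close>; by irreducibility exactly one
  of them is the identity, which matches \<open>E\<^sub>i\<close> with \<open>r\<^sub>j E\<close>. The number of loops is the dimension of the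
  space of all loops, and the number of coloops is then read off from the dimension of \<open>E\<close>.\<close>

(* Pointwise evaluation would rewrite even unapplied sums of vectors into abstractions. *)
declare plus_fun_apply [simp del] zero_fun_apply [simp del] minus_apply [simp del]

section \<open>Finite-dimensional subspaces\<close>

lemma (in vector_space) exists_projection_along:
  assumes "subspace A" "subspace B" "A \<inter> B = {0}"
  obtains p where "Vector_Spaces.linear scale scale p" "\<And>x. p x \<in> A" "\<And>x. x \<in> A \<Longrightarrow> p x = x"
    "\<And>x. x \<in> B \<Longrightarrow> p x = 0"
proof -
  interpret vector_space_pair scale scale ..
  obtain q where q: "Vector_Spaces.linear scale scale q" "range q \<subseteq> B" "\<And>x. x \<in> B \<Longrightarrow> q x = x"
    using linear_exists_left_inverse_on[OF linear_ident assms(2)] by auto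
  let ?h = "\<lambda>x. x - q x"
  have h: "Vector_Spaces.linear scale scale ?h" using linear_compose_sub[OF linear_ident q(1)] .
  have "inj_on ?h A"
  proof (rule linear_inj_on_iff_eq_0[OF h assms(1), THEN iffD2], intro ballI impI)
    fix x assume "x \<in> A" "x - q x = 0"
    moreover from this have "x \<in> B" using q(2) by auto
    ultimately show "x = 0" using assms(3) by blast
  qed
  then obtain k
    where k: "Vector_Spaces.linear scale scale k" "range k \<subseteq> A" "\<And>x. x \<in> A \<Longrightarrow> k (?h x) = x"
    using linear_exists_left_inverse_on[OF h assms(1)] by auto
  show ?thesis
  proof
    show "Vector_Spaces.linear scale scale (\<lambda>x. k (?h x))"
      using Vector_Spaces.linear_compose[OF h k(1)] by (simp add: comp_def)
    show "k (?h x) = 0" if "x \<in> B" for x using q(3)[OF that] linear_0[OF k(1)] by simp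
  qed (use k in auto)
qed

context vector_space
begin

definition fin_dim :: "'b set \<Rightarrow> bool" where
  "fin_dim V \<longleftrightarrow> (\<exists>T. finite T \<and> V \<subseteq> span T)"

lemma fin_dim_subset: "fin_dim W \<Longrightarrow> V \<subseteq> W \<Longrightarrow> fin_dim V"
  unfolding fin_dim_def by blast

lemma fin_dim_span_Un:
  assumes "fin_dim V" "fin_dim W" shows "fin_dim (span (V \<union> W))"
proof -
  obtain S T where "finite S" "V \<subseteq> span S" "finite T" "W \<subseteq> span T"
    using assms by (auto simp: fin_dim_def)
  moreover from this have "span (V \<union> W) \<subseteq> span (S \<union> T)"
    using span_mono[of S "S \<union> T"] span_mono[of T "S \<union> T"] by (intro span_minimal) auto
  ultimately show ?thesis unfolding fin_dim_def by (meson finite_UnI)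
qed

lemma fin_dim_basis:
  assumes "fin_dim V" "subspace V"
  obtains B where "finite B" "independent B" "span B = V" "card B = dim V"
proof -
  obtain B where "B \<subseteq> V" "independent B" "V \<subseteq> span B" "card B = dim V" using basis_exists .
  moreover from this have "finite B"
    using assms(1) independent_span_bound unfolding fin_dim_def by (metis subset_trans)
  ultimately show ?thesis using that span_subspace assms(2) by blast
qed

lemma dim_le_if_subset:
  assumes "V \<subseteq> W" "subspace W" "fin_dim W" shows "dim V \<le> dim W"
proof -
  obtain B where "finite B" "span B = W" "card B = dim W" using fin_dim_basis[OF assms(3,2)] .
  then show ?thesis using dim_le_card[of V B] assms(1) by simp
qed

lemma span_Un_subspaces:
  "subspace A \<Longrightarrow> subspace B \<Longrightarrow> span (A \<union> B) = {a + b | a b. a \<in> A \<and> b \<in> B}"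
  by (simp add: span_Un span_eq_iff[THEN iffD2])

lemma span_Un_absorb: "subspace W \<Longrightarrow> V \<subseteq> W \<Longrightarrow> span (V \<union> W) = W"
  by (simp add: sup_absorb2 span_eq_iff[THEN iffD2])

lemma independent_Un:
  assumes "finite T" "independent S" "independent T" "span S \<inter> span T = {0}"
  shows "independent (S \<union> T)"
  using assms
proof (induction T rule: finite_induct)
  case (insert t T)
  have T: "independent T" "t \<notin> span T" using insert by (auto simp: independent_insert)
  have "span T \<subseteq> span (insert t T)" by (simp add: span_mono subset_insertI)
  then have "span S \<inter> span T = {0}" using insert.prems span_zero by blast
  then have "independent (S \<union> T)" using insert T by blast
  moreover have "t \<notin> span (S \<union> T)"
  proof
    assume "t \<in> span (S \<union> T)"
    then obtain s u where su: "t = s + u" "s \<in> span S" "u \<in> span T" unfolding span_Un by blast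
    have "t - u \<in> span (insert t T)"
      using span_diff[OF span_base[of t "insert t T"], of u] su(3) \<open>span T \<subseteq> _\<close> by auto
    moreover have "t - u = s" using su(1) by simp
    ultimately have "s = 0" using su(2) insert.prems by blast
    then show False using su(1,3) T by simp
  qed
  ultimately show ?case by (simp add: independent_insertI)
qed simp

lemma dim_direct_sum:
  assumes "subspace A" "subspace B" "fin_dim A" "fin_dim B" "A \<inter> B = {0}"
  shows "dim (span (A \<union> B)) = dim A + dim B"
proof -
  obtain S where S: "finite S" "independent S" "span S = A" "card S = dim A"
    using fin_dim_basis assms by blast
  obtain T where T: "finite T" "independent T" "span T = B" "card T = dim B"
    using fin_dim_basis assms by blast
  have "span (A \<union> B) = span (S \<union> T)"
    unfolding span_Un S(3)[symmetric] T(3)[symmetric] span_span ..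
  moreover have "S \<inter> T = {}"
  proof -
    have "S \<inter> T \<subseteq> {0}" using assms(5) S(3) T(3) span_base by blast
    then show ?thesis using S(2) dependent_zero by blast
  qed
  ultimately show ?thesis
    using dim_span_eq_card_independent[OF independent_Un[OF T(1) S(2) T(2)]] S T assms(5)
    by (simp add: card_Un_disjoint)
qed

lemma exists_complement:
  assumes "subspace A" "subspace B" "fin_dim B" "A \<subseteq> B"
  obtains C where "subspace C" "C \<subseteq> B" "A \<inter> C = {0}" "span (A \<union> C) = B" "dim B = dim A + dim C"
proof -
  interpret vector_space_pair scale scale ..
  have "A \<inter> {0} = {0}" using subspace_0[OF assms(1)] by simp
  then obtain p where p: "Vector_Spaces.linear scale scale p" "\<And>x. p x \<in> A" "\<And>x. x \<in> A \<Longrightarrow> p x = x"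
    using exists_projection_along[OF assms(1) subspace_single_0] by metis
  let ?C = "B \<inter> {x. p x = 0}"
  have C: "subspace ?C" using subspace_inter assms(2) linear_subspace_kernel[OF p(1)] by blast
  have int: "A \<inter> ?C = {0}" using p(3) assms subspace_0 by auto
  have sum: "span (A \<union> ?C) = B"
  proof
    show "span (A \<union> ?C) \<subseteq> B" using assms by (intro span_minimal) auto
    show "B \<subseteq> span (A \<union> ?C)"
    proof
      fix x assume "x \<in> B"
      then have "x - p x \<in> ?C"
        using p assms by (auto simp: linear_diff[OF p(1)] intro: subspace_diff)
      then have "p x + (x - p x) \<in> span (A \<union> ?C)" using p(2) by (intro span_add span_base) auto
      then show "x \<in> span (A \<union> ?C)" by simp
    qed
  qed
  have "dim B = dim A + dim ?C"
    using dim_direct_sum[OF assms(1) C _ _ int] sum assms fin_dim_subset by auto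
  then show ?thesis using that C int sum by blast
qed

lemma dim_less_if_psubset:
  assumes "V \<subset> W" "subspace V" "subspace W" "fin_dim W" shows "dim V < dim W"
proof -
  obtain C where C: "subspace C" "C \<subseteq> W" "span (V \<union> C) = W" "dim W = dim V + dim C"
    using exists_complement assms by (metis psubset_imp_subset)
  have "dim C \<noteq> 0"
  proof
    assume "dim C = 0"
    moreover obtain B where "finite B" "span B = C" "card B = dim C"
      using fin_dim_basis[OF fin_dim_subset[OF assms(4) C(2)] C(1)] .
    ultimately have "C = {0}" by auto
    then have "span (V \<union> C) = V" using span_Un_absorb[OF assms(2), of C] subspace_0[OF assms(2)]
      by (simp add: Un_commute)
    then show False using C(3) assms(1) by simp
  qed
  then show ?thesis using C(4) by simp
qed

lemma dim_span_Un_Int: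
  assumes A: "subspace A" "fin_dim A" and B: "subspace B" "fin_dim B"
  shows "dim (span (A \<union> B)) + dim (A \<inter> B) = dim A + dim B"
proof -
  obtain C where C: "subspace C" "C \<subseteq> B" "(A \<inter> B) \<inter> C = {0}" "span ((A \<inter> B) \<union> C) = B"
    "dim B = dim (A \<inter> B) + dim C"
    using exists_complement[OF subspace_inter[OF A(1) B(1)] B] by blast
  have "span (A \<union> B) = span (A \<union> C)"
  proof (rule span_eq[THEN iffD2], intro conjI)
    have "B \<subseteq> span (A \<union> C)" using C(4) span_mono[of "(A \<inter> B) \<union> C" "A \<union> C"] by blast
    then show "A \<union> B \<subseteq> span (A \<union> C)" using span_superset by blast
    show "A \<union> C \<subseteq> span (A \<union> B)" using C(2) span_superset by blast
  qed
  moreover have "A \<inter> C = {0}" using C(2,3) by blast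
  ultimately show ?thesis
    using dim_direct_sum[OF A(1) C(1) A(2) fin_dim_subset[OF B(2) C(2)]] C(5) by simp
qed

lemma dim_span_singleton: "x \<noteq> 0 \<Longrightarrow> dim (span {x}) = 1"
  using dim_span_eq_card_independent[of "{x}"] by simp

lemma span_singleton_eq_if_mem:
  assumes "x \<in> span {y}" "x \<noteq> 0" shows "span {x} = span {y}"
proof -
  obtain c where c: "x = scale c y" using assms(1) by (auto simp: span_singleton)
  then have "c \<noteq> 0" using assms(2) by auto
  then show ?thesis using span_image_scale[of "{y}" "\<lambda>_. c"] c by simp
qed

lemma span_singleton_Int:
  assumes "subspace V" "x \<notin> V" shows "span {x} \<inter> V = {0}"
proof -
  have "y = 0" if y: "y \<in> span {x}" "y \<in> V" for y
  proof (rule ccontr)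
    assume "y \<noteq> 0"
    then have "x \<in> span {y}" using span_singleton_eq_if_mem[OF y(1)] span_base by blast
    then show False using span_minimal[of "{y}" V] y(2) assms by blast
  qed
  then show ?thesis using span_zero subspace_0[OF assms(1)] by blast
qed

lemma subspace_of_span_singleton:
  assumes "subspace V" "V \<subseteq> span {x}" "V \<noteq> {0}" shows "V = span {x}"
proof -
  obtain v where v: "v \<in> V" "v \<noteq> 0" using assms(1,3) subspace_0 by blast
  then have "span {x} = span {v}" using span_singleton_eq_if_mem[of v x] assms(2) by auto
  also have "\<dots> \<subseteq> V" using span_minimal[of "{v}" V] assms(1) v(1) by simp
  finally show ?thesis using assms(2) by blast
qed

end

context vector_space_pair
begin

lemma exists_linear_extension:
  assumes V: "vs1.subspace V"
    and add: "\<And>x y. x \<in> V \<Longrightarrow> y \<in> V \<Longrightarrow> f (x + y) = f x + f y"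
    and scale: "\<And>c x. x \<in> V \<Longrightarrow> f (s1 c x) = s2 c (f x)"
  obtains g where "Vector_Spaces.linear s1 s2 g" "\<And>x. x \<in> V \<Longrightarrow> g x = f x"
proof -
  obtain B where B: "B \<subseteq> V" "vs1.independent B" "V \<subseteq> vs1.span B"
    using vs1.maximal_independent_subset .
  obtain g where g: "Vector_Spaces.linear s1 s2 g" "\<forall>x\<in>B. g x = f x"
    using linear_independent_extend[OF B(2)] by blast
  have "f 0 = 0" using scale[of 0 0] vs1.subspace_0[OF V] by simp
  then have "vs1.subspace {x \<in> V. g x = f x}"
    using V add scale by (intro vs1.subspaceI)
      (auto simp: linear_0[OF g(1)] linear_add[OF g(1)] linear_scale[OF g(1)]
        vs1.subspace_0 vs1.subspace_add vs1.subspace_scale)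
  then have "vs1.span B \<subseteq> {x \<in> V. g x = f x}" using B(1) g(2) by (intro vs1.span_minimal) auto
  then show ?thesis using that g(1) B(3) by blast
qed

lemma dim_image_inj_on:
  assumes f: "Vector_Spaces.linear s1 s2 f" and V: "vs1.subspace V" "inj_on f V"
  shows "vs2.dim (f ` V) = vs1.dim V"
proof -
  obtain B where B: "B \<subseteq> V" "vs1.independent B" "V \<subseteq> vs1.span B" "card B = vs1.dim V"
    using vs1.basis_exists .
  have "vs1.span B = V" using B V vs1.span_subspace by blast
  then have "vs2.independent (f ` B)" "f ` V = vs2.span (f ` B)"
    using linear_independent_injective_image[OF f B(2)] V linear_span_image[OF f, of B] by simp_all
  then show ?thesis
    using B(4) vs2.dim_span_eq_card_independent card_image[OF inj_on_subset[OF V(2) B(1)]] by simp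
qed

lemma fin_dim_image:
  assumes "Vector_Spaces.linear s1 s2 f" "vs1.fin_dim V" shows "vs2.fin_dim (f ` V)"
proof -
  obtain T where "finite T" "V \<subseteq> vs1.span T" using assms(2) by (auto simp: vs1.fin_dim_def)
  then have "finite (f ` T)" "f ` V \<subseteq> vs2.span (f ` T)"
    using linear_span_image[OF assms(1), of T] by auto
  then show ?thesis unfolding vs2.fin_dim_def by blast
qed

lemma dim_image_plus_dim_kernel:
  assumes f: "Vector_Spaces.linear s1 s2 f" and V: "vs1.subspace V" "vs1.fin_dim V"
  shows "vs2.dim (f ` V) + vs1.dim {x \<in> V. f x = 0} = vs1.dim V"
proof -
  let ?K = "{x \<in> V. f x = 0}"
  have K: "vs1.subspace ?K"
    using vs1.subspace_inter[OF V(1) linear_subspace_kernel[OF f]] by (simp add: Int_def)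
  obtain C where C: "vs1.subspace C" "C \<subseteq> V" "?K \<inter> C = {0}" "vs1.span (?K \<union> C) = V"
    "vs1.dim V = vs1.dim ?K + vs1.dim C"
    using vs1.exists_complement[OF K V] by blast
  have "inj_on f C" using linear_inj_on_iff_eq_0[OF f C(1)] C(2,3) by blast
  moreover have "f ` V = f ` C"
  proof
    have "f x \<in> f ` C" if x: "x \<in> vs1.span (?K \<union> C)" for x
    proof -
      obtain k c where "x = k + c" "f k = 0" "c \<in> C"
        using x vs1.span_Un_subspaces[OF K C(1)] by auto
      then show ?thesis using linear_add[OF f] by auto
    qed
    then show "f ` V \<subseteq> f ` C" using C(4) by blast
  qed (use C(2) in blast)
  ultimately show ?thesis using dim_image_inj_on[OF f C(1)] C(5) by simp
qed

lemma dim_preimage: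
  assumes f: "Vector_Spaces.linear s1 s2 f" and V: "vs1.subspace V" "vs1.fin_dim V"
    and W: "vs2.subspace W" "W \<subseteq> f ` V"
  shows "vs1.dim {x \<in> V. f x \<in> W} + vs2.dim (f ` V) = vs1.dim V + vs2.dim W"
proof -
  let ?U = "{x \<in> V. f x \<in> W}"
  have "vs1.subspace ?U"
    using vs1.subspace_inter[OF V(1) linear_subspace_linear_preimage[OF f W(1)]]
    by (simp add: Int_def)
  moreover have "vs1.fin_dim ?U" by (rule vs1.fin_dim_subset[OF V(2)]) blast
  moreover have "f ` ?U = W" using W(2) by blast
  moreover have "{x \<in> ?U. f x = 0} = {x \<in> V. f x = 0}" using vs2.subspace_0[OF W(1)] by auto
  ultimately show ?thesis
    using dim_image_plus_dim_kernel[OF f, of ?U] dim_image_plus_dim_kernel[OF f V] by simp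
qed

end

global_interpretation fvp: vector_space_pair
  "fscale :: 'f::field \<Rightarrow> (nat \<Rightarrow> 'f) \<Rightarrow> (nat \<Rightarrow> 'f)" "fscale :: 'f \<Rightarrow> (nat \<Rightarrow> 'f) \<Rightarrow> (nat \<Rightarrow> 'f)" ..

abbreviation flinear :: "((nat \<Rightarrow> 'f::field) \<Rightarrow> (nat \<Rightarrow> 'f)) \<Rightarrow> bool" where
  "flinear \<equiv> Vector_Spaces.linear fscale fscale"

lemma flinear_comp: "flinear f \<Longrightarrow> flinear g \<Longrightarrow> flinear (\<lambda>x. g (f x))"
  using Vector_Spaces.linear_compose[of fscale fscale f fscale g] by (simp add: comp_def)

section \<open>Rank, nullity and cyclic subspaces\<close>

text \<open>The subtraction never truncates on subspaces of a q-matroid.\<close>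
definition nullity :: "((nat \<Rightarrow> 'f::field) set \<Rightarrow> nat) \<Rightarrow> (nat \<Rightarrow> 'f) set \<Rightarrow> nat" where
  "nullity \<rho> V = fv.dim V - \<rho> V"

definition cyclic :: "((nat \<Rightarrow> 'f::field) set \<Rightarrow> nat) \<Rightarrow> (nat \<Rightarrow> 'f) set \<Rightarrow> bool" where
  "cyclic \<rho> X \<longleftrightarrow> fv.subspace X \<and> (\<forall>Y\<in>subspaces X. Y \<noteq> X \<longrightarrow> nullity \<rho> Y < nullity \<rho> X)"

lemma subspaces_trans: "V \<in> subspaces W \<Longrightarrow> W \<subseteq> E \<Longrightarrow> V \<in> subspaces E"
  by (auto simp: subspaces_def)

lemma subspaces_image: "flinear f \<Longrightarrow> V \<in> subspaces E \<Longrightarrow> f ` V \<in> subspaces (f ` E)"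
  by (auto simp: subspaces_def intro: fvp.linear_subspace_image)

lemma qmatroidI:
  assumes "fv.subspace E" "fv.fin_dim E"
    and "\<And>V. V \<in> subspaces E \<Longrightarrow> \<rho> V \<le> fv.dim V"
    and "\<And>V W. V \<in> subspaces E \<Longrightarrow> W \<in> subspaces E \<Longrightarrow> V \<subseteq> W \<Longrightarrow> \<rho> V \<le> \<rho> W"
    and "\<And>V W. V \<in> subspaces E \<Longrightarrow> W \<in> subspaces E \<Longrightarrow>
        \<rho> (fv.span (V \<union> W)) + \<rho> (V \<inter> W) \<le> \<rho> V + \<rho> W"
  shows "qmatroid (E, \<rho>)"
proof -
  obtain B where "finite B" "fv.span B = E" using fv.fin_dim_basis[OF assms(2,1)] .
  then show ?thesis using assms(3-5) unfolding qmatroid_def by simp blast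
qed

locale q_matroid =
  fixes E :: "(nat \<Rightarrow> 'f::field) set" and \<rho> :: "(nat \<Rightarrow> 'f) set \<Rightarrow> nat"
  assumes qmatroid: "qmatroid (E, \<rho>)"
begin

lemma subspace_ground: "fv.subspace E"
  using qmatroid by (auto simp: qmatroid_def)

lemma fin_dim_ground: "fv.fin_dim E"
  using qmatroid by (auto simp: qmatroid_def fv.fin_dim_def)

lemma ground_mem: "E \<in> subspaces E"
  by (simp add: subspaces_def subspace_ground)

lemma zero_mem: "{0} \<in> subspaces E"
  using subspace_ground fv.subspace_0 by (auto simp: subspaces_def)

lemma subspacesD:
  assumes "V \<in> subspaces E" shows "fv.subspace V" "V \<subseteq> E" "fv.fin_dim V"
  using assms fv.fin_dim_subset[OF fin_dim_ground] by (auto simp: subspaces_def)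

lemma span_Un_mem: "V \<in> subspaces E \<Longrightarrow> W \<in> subspaces E \<Longrightarrow> fv.span (V \<union> W) \<in> subspaces E"
  using fv.span_minimal[OF _ subspace_ground, of "V \<union> W"] by (auto simp: subspaces_def)

lemma span_singleton_mem: "x \<in> E \<Longrightarrow> fv.span {x} \<in> subspaces E"
  using subspace_ground by (simp add: subspaces_def fv.span_minimal)

lemma Int_mem: "V \<in> subspaces E \<Longrightarrow> W \<in> subspaces E \<Longrightarrow> V \<inter> W \<in> subspaces E"
  by (auto simp: subspaces_def fv.subspace_inter)

lemma image_mem: "flinear f \<Longrightarrow> V \<in> subspaces E \<Longrightarrow> f ` V \<subseteq> E \<Longrightarrow> f ` V \<in> subspaces E"
  by (simp add: subspaces_def fvp.linear_subspace_image)

lemma rank_le_dim: "V \<in> subspaces E \<Longrightarrow> \<rho> V \<le> fv.dim V"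
  and rank_mono: "V \<in> subspaces E \<Longrightarrow> W \<in> subspaces E \<Longrightarrow> V \<subseteq> W \<Longrightarrow> \<rho> V \<le> \<rho> W"
  and rank_submodular: "V \<in> subspaces E \<Longrightarrow> W \<in> subspaces E \<Longrightarrow>
        \<rho> (fv.span (V \<union> W)) + \<rho> (V \<inter> W) \<le> \<rho> V + \<rho> W"
  using qmatroid by (auto simp: qmatroid_def)

lemma rank_zero: "\<rho> {0} = 0"
  using rank_le_dim[OF zero_mem] fv.dim_le_card[of "{0 :: nat \<Rightarrow> 'f}" "{}"] by simp

lemma rank_subadditive:
  assumes "V \<in> subspaces E" "A \<in> subspaces E" "B \<in> subspaces E"
    and "\<And>x. x \<in> V \<Longrightarrow> \<exists>a\<in>A. \<exists>b\<in>B. x = a + b"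
  shows "\<rho> V \<le> \<rho> A + \<rho> B"
proof -
  have "V \<subseteq> fv.span (A \<union> B)"
    using assms fv.span_Un_subspaces[OF subspacesD(1) subspacesD(1)] by fast
  then have "\<rho> V \<le> \<rho> (fv.span (A \<union> B))" using assms span_Un_mem rank_mono by blast
  then show ?thesis using rank_submodular[of A B] assms by linarith
qed

lemma rank_image_sum_le:
  assumes V: "V \<in> subspaces E" and "finite I"
    and "\<And>i. i \<in> I \<Longrightarrow> flinear (f i)" "\<And>i. i \<in> I \<Longrightarrow> f i ` V \<subseteq> E"
  shows "\<rho> ((\<lambda>x. \<Sum>i\<in>I. f i x) ` V) \<le> (\<Sum>i\<in>I. \<rho> (f i ` V))"
  using assms(2-)
proof (induction I rule: finite_induct)
  case empty
  have "(\<lambda>x. \<Sum>i\<in>{}. f i x) ` V = {0}" using V fv.subspace_0 by (auto simp: subspaces_def)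
  then show ?case by (simp add: rank_zero)
next
  case (insert a I)
  let ?g = "\<lambda>J x. \<Sum>i\<in>J. f i x"
  have mem: "?g J ` V \<in> subspaces E" if "J \<subseteq> insert a I" for J
  proof (rule image_mem[OF _ V])
    show "flinear (?g J)" using insert.prems that by (intro fvp.linear_compose_sum) blast
    show "?g J ` V \<subseteq> E"
    proof clarify
      fix v assume "v \<in> V"
      then show "?g J v \<in> E" using insert.prems(2) that
        by (intro fv.subspace_sum[OF subspace_ground]) blast
    qed
  qed
  have "\<rho> (?g (insert a I) ` V) \<le> \<rho> (f a ` V) + \<rho> (?g I ` V)"
  proof (rule rank_subadditive)
    fix x assume "x \<in> ?g (insert a I) ` V"
    then obtain v where "v \<in> V" "x = f a v + ?g I v" using insert.hyps by auto
    then show "\<exists>u\<in>f a ` V. \<exists>b\<in>?g I ` V. x = u + b" by blast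
  next
    show "f a ` V \<in> subspaces E" using mem[of "{a}"] by simp
  qed (use mem in blast)+
  moreover have "\<rho> (?g I ` V) \<le> (\<Sum>i\<in>I. \<rho> (f i ` V))" using insert.IH insert.prems by blast
  ultimately show ?case using insert.hyps by simp
qed

lemma rank_add_dim_le:
  assumes "V \<in> subspaces E" "W \<in> subspaces E" "V \<subseteq> W"
  shows "\<rho> W + fv.dim V \<le> \<rho> V + fv.dim W"
proof -
  obtain C where C: "fv.subspace C" "C \<subseteq> W" "fv.span (V \<union> C) = W" "fv.dim W = fv.dim V + fv.dim C"
    using fv.exists_complement[of V W] assms subspacesD by metis
  then have CE: "C \<in> subspaces E" using assms(2) by (auto simp: subspaces_def)
  have "\<rho> W \<le> \<rho> V + \<rho> C" using rank_submodular[OF assms(1) CE] C(3) by simp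
  then show ?thesis using rank_le_dim[OF CE] C(4) by linarith
qed

lemma nullity_add_rank: "V \<in> subspaces E \<Longrightarrow> nullity \<rho> V + \<rho> V = fv.dim V"
  by (simp add: nullity_def rank_le_dim)

lemma nullity_mono:
  "V \<in> subspaces E \<Longrightarrow> W \<in> subspaces E \<Longrightarrow> V \<subseteq> W \<Longrightarrow> nullity \<rho> V \<le> nullity \<rho> W"
  using rank_add_dim_le[of V W] nullity_add_rank[of V] nullity_add_rank[of W] by linarith

lemma nullity_supermodular:
  assumes "V \<in> subspaces E" "W \<in> subspaces E"
  shows "nullity \<rho> V + nullity \<rho> W \<le> nullity \<rho> (fv.span (V \<union> W)) + nullity \<rho> (V \<inter> W)"
proof -
  have "fv.dim (fv.span (V \<union> W)) + fv.dim (V \<inter> W) = fv.dim V + fv.dim W"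
    using assms subspacesD by (intro fv.dim_span_Un_Int) auto
  then show ?thesis
    using rank_submodular[OF assms] nullity_add_rank[OF assms(1)] nullity_add_rank[OF assms(2)]
      nullity_add_rank[OF span_Un_mem[OF assms]] nullity_add_rank[OF Int_mem[OF assms]]
    by linarith
qed

lemma q_matroid_restrict:
  assumes E': "E' \<in> subspaces E" shows "q_matroid E' \<rho>"
proof (unfold_locales, rule qmatroidI)
  have mem: "V \<in> subspaces E" if "V \<in> subspaces E'" for V
    using subspaces_trans[OF that subspacesD(2)[OF E']] .
  show "\<rho> V \<le> fv.dim V" if "V \<in> subspaces E'" for V
    using rank_le_dim[OF mem[OF that]] .
  show "\<rho> V \<le> \<rho> W" if "V \<in> subspaces E'" "W \<in> subspaces E'" "V \<subseteq> W" for V W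
    using rank_mono[OF mem mem] that .
  show "\<rho> (fv.span (V \<union> W)) + \<rho> (V \<inter> W) \<le> \<rho> V + \<rho> W"
    if "V \<in> subspaces E'" "W \<in> subspaces E'" for V W
    using rank_submodular[OF mem mem] that .
qed (use subspacesD[OF E'] in simp_all)

lemma exists_cyclic:
  assumes V: "V \<in> subspaces E"
  obtains X where "X \<in> subspaces V" "cyclic \<rho> X" "nullity \<rho> X = nullity \<rho> V"
proof -
  define P where "P X \<longleftrightarrow> X \<in> subspaces V \<and> nullity \<rho> X = nullity \<rho> V" for X
  have "P V" using V by (simp add: P_def subspaces_def)
  then obtain X where X: "P X" "\<And>Y. P Y \<Longrightarrow> fv.dim X \<le> fv.dim Y"
    using arg_min_nat_lemma[of P V fv.dim] by metis
  have XE: "X \<in> subspaces E" using X(1) V by (auto simp: P_def subspaces_def)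
  have "nullity \<rho> Y < nullity \<rho> X" if Y: "Y \<in> subspaces X" "Y \<noteq> X" for Y
  proof -
    have YE: "Y \<in> subspaces E" "Y \<in> subspaces V" "Y \<subset> X"
      using Y X(1) XE by (auto simp: P_def subspaces_def)
    have "fv.dim Y < fv.dim X"
      using fv.dim_less_if_psubset[OF YE(3) subspacesD(1)[OF YE(1)]] subspacesD[OF XE] by blast
    then have "\<not> P Y" using X(2)[of Y] by linarith
    then show ?thesis using nullity_mono[OF YE(1) XE] X(1) YE by (auto simp: P_def)
  qed
  then have "cyclic \<rho> X" using XE by (simp add: cyclic_def subspaces_def)
  then show ?thesis using that X(1) unfolding P_def by blast
qed

lemma cyclic_subset_if_nullity_eq_ground:
  assumes Y: "Y \<in> subspaces E" "nullity \<rho> Y = nullity \<rho> E" and X: "X \<in> subspaces E" "cyclic \<rho> X"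
  shows "X \<subseteq> Y"
proof -
  have "nullity \<rho> X + nullity \<rho> Y \<le> nullity \<rho> (fv.span (X \<union> Y)) + nullity \<rho> (X \<inter> Y)"
    using nullity_supermodular[OF X(1) Y(1)] .
  also have "nullity \<rho> (fv.span (X \<union> Y)) \<le> nullity \<rho> E"
    using span_Un_mem[OF X(1) Y(1)] by (intro nullity_mono ground_mem subspacesD(2))
  finally have "nullity \<rho> X \<le> nullity \<rho> (X \<inter> Y)" using Y(2) by simp
  moreover have "X \<inter> Y \<in> subspaces X" using Int_mem[OF X(1) Y(1)] by (simp add: subspaces_def)
  ultimately have "X \<inter> Y = X" using X(2) unfolding cyclic_def by (meson not_le)
  then show ?thesis by blast
qed

lemma cyclic_if_rank_zero:
  assumes X: "X \<in> subspaces E" "\<rho> X = 0"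
  shows "cyclic \<rho> X"
  unfolding cyclic_def
proof (intro conjI ballI impI)
  fix Y assume Y: "Y \<in> subspaces X" "Y \<noteq> X"
  then have "fv.dim Y < fv.dim X"
    using X(1) subspacesD[OF X(1)] by (intro fv.dim_less_if_psubset) (auto simp: subspaces_def)
  then show "nullity \<rho> Y < nullity \<rho> X" using X(2) by (simp add: nullity_def)
qed (use subspacesD(1)[OF X(1)] in simp)

context
  fixes X I g
  assumes X: "X \<in> subspaces E" and I: "finite I" and lin: "\<And>i. i \<in> I \<Longrightarrow> flinear (g i)"
    and gE: "\<And>i. i \<in> I \<Longrightarrow> g i ` X \<subseteq> E" and sum: "\<And>x. x \<in> X \<Longrightarrow> (\<Sum>i\<in>I. g i x) = x"
    and rank: "(\<Sum>i\<in>I. \<rho> (g i ` X)) \<le> \<rho> X"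
begin

lemma rank_add_rank_image_le:
  assumes k: "k \<in> I" and U: "U \<in> subspaces X"
  shows "\<rho> U + \<rho> (g k ` X) \<le> \<rho> (g k ` U) + \<rho> X"
proof -
  have UE: "U \<in> subspaces E" and UX: "U \<subseteq> X"
    using subspaces_trans[OF U subspacesD(2)[OF X]] U by (simp_all add: subspaces_def)
  have mem: "g i ` V \<in> subspaces E" if "i \<in> I" "V \<in> subspaces E" "V \<subseteq> X" for i V
    using gE[OF that(1)] that(3) by (intro image_mem[OF lin[OF that(1)] that(2)]) blast
  have "(\<lambda>x. \<Sum>i\<in>I. g i x) ` U = (\<lambda>x. x) ` U" using sum UX by (intro image_cong) auto
  then have "\<rho> U = \<rho> ((\<lambda>x. \<Sum>i\<in>I. g i x) ` U)" by simp
  also have "\<dots> \<le> (\<Sum>i\<in>I. \<rho> (g i ` U))"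
    using UE UX I lin gE by (intro rank_image_sum_le) blast+
  also have "\<dots> = \<rho> (g k ` U) + (\<Sum>i\<in>I - {k}. \<rho> (g i ` U))"
    using I k by (simp add: sum.remove)
  also have "\<dots> \<le> \<rho> (g k ` U) + (\<Sum>i\<in>I - {k}. \<rho> (g i ` X))"
    using mem[OF _ UE UX] mem[OF _ X order_refl] UX
    by (intro add_left_mono sum_mono rank_mono) auto
  finally show ?thesis using rank sum.remove[OF I k, of "\<lambda>i. \<rho> (g i ` X)"] by simp
qed

lemma cyclic_image:
  assumes k: "k \<in> I" and "cyclic \<rho> X"
  shows "cyclic \<rho> (g k ` X)"
  unfolding cyclic_def
proof (intro conjI ballI impI)
  have gX: "g k ` X \<in> subspaces E" using image_mem[OF lin X gE] k by simp
  then show "fv.subspace (g k ` X)" by (rule subspacesD(1))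
  fix Y assume Y: "Y \<in> subspaces (g k ` X)" "Y \<noteq> g k ` X"
  have YE: "Y \<in> subspaces E" using subspaces_trans[OF Y(1) gE[OF k]] .
  let ?U = "{x \<in> X. g k x \<in> Y}"
  have U: "?U \<in> subspaces X"
    using fv.subspace_inter[OF subspacesD(1)[OF X]
        fvp.linear_subspace_linear_preimage[OF lin[OF k] subspacesD(1)[OF YE]]]
    by (simp add: Int_def subspaces_def)
  have "g k ` ?U = Y" using Y(1) by (auto simp: subspaces_def)
  then have "\<rho> ?U + \<rho> (g k ` X) \<le> \<rho> Y + \<rho> X"
    using rank_add_rank_image_le[OF k U] by simp
  moreover have "fv.dim ?U + fv.dim (g k ` X) = fv.dim X + fv.dim Y"
    using Y(1) subspacesD[OF X] lin[OF k]
    by (intro fvp.dim_preimage) (auto simp: subspaces_def)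
  moreover have "nullity \<rho> ?U < nullity \<rho> X"
  proof -
    have "?U \<noteq> X" using Y by (auto simp: subspaces_def)
    then show ?thesis using assms(2) U by (simp add: cyclic_def)
  qed
  ultimately show "nullity \<rho> Y < nullity \<rho> (g k ` X)"
    using nullity_add_rank[OF subspaces_trans[OF U subspacesD(2)[OF X]]]
      nullity_add_rank[OF X] nullity_add_rank[OF YE] nullity_add_rank[OF gX] by linarith
qed

end

end

section \<open>Equivalences\<close>

definition qm_iso :: "((nat \<Rightarrow> 'f::field) \<Rightarrow> (nat \<Rightarrow> 'f)) \<Rightarrow> 'f qm \<Rightarrow> 'f qm \<Rightarrow> bool" where
  "qm_iso \<alpha> M N \<longleftrightarrow> flinear \<alpha> \<and> bij_betw \<alpha> (fst M) (fst N) \<and>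
     (\<forall>V\<in>subspaces (fst M). snd N (\<alpha> ` V) = snd M V)"

lemma qm_isoD:
  assumes "qm_iso \<alpha> M N"
  shows "flinear \<alpha>" "bij_betw \<alpha> (fst M) (fst N)" "\<alpha> ` fst M = fst N" "inj_on \<alpha> (fst M)"
    "V \<in> subspaces (fst M) \<Longrightarrow> snd N (\<alpha> ` V) = snd M V"
  using assms by (auto simp: qm_iso_def bij_betw_def)

lemma qm_equiv_if_iso: "qm_iso \<alpha> M N \<Longrightarrow> qm_equiv M N"
  unfolding qm_iso_def qm_equiv_def
  by (auto simp: fvp.linear_add fvp.linear_scale split: prod.splits)

lemma qm_equiv_imp_iso:
  assumes "qm_equiv M N" and M: "fv.subspace (fst M)"
  obtains \<alpha> where "qm_iso \<alpha> M N"
proof -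
  obtain f where f: "bij_betw f (fst M) (fst N)"
      "\<And>x y. x \<in> fst M \<Longrightarrow> y \<in> fst M \<Longrightarrow> f (x + y) = f x + f y"
      "\<And>c x. x \<in> fst M \<Longrightarrow> f (fscale c x) = fscale c (f x)"
      "\<And>V. V \<in> subspaces (fst M) \<Longrightarrow> snd N (f ` V) = snd M V"
    using assms(1) unfolding qm_equiv_def case_prod_beta by blast
  obtain \<alpha> where \<alpha>: "flinear \<alpha>" "\<And>x. x \<in> fst M \<Longrightarrow> \<alpha> x = f x"
    using fvp.exists_linear_extension[OF M f(2,3)] by metis
  have "\<alpha> ` V = f ` V" if "V \<in> subspaces (fst M)" for V
    using that \<alpha>(2) by (intro image_cong) (auto simp: subspaces_def)
  moreover have "bij_betw \<alpha> (fst M) (fst N)" using f(1) \<alpha>(2) bij_betw_cong by metis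
  ultimately have "qm_iso \<alpha> M N" using \<alpha>(1) f(4) by (simp add: qm_iso_def)
  then show ?thesis using that by blast
qed

lemma qm_iso_id: "qm_iso (\<lambda>x. x) M M"
  by (simp add: qm_iso_def fv.linear_ident bij_betw_def)

lemma qm_iso_comp:
  assumes \<alpha>: "qm_iso \<alpha> L M" and \<beta>: "qm_iso \<beta> M N"
  shows "qm_iso (\<lambda>x. \<beta> (\<alpha> x)) L N"
  unfolding qm_iso_def
proof (intro conjI ballI)
  show "flinear (\<lambda>x. \<beta> (\<alpha> x))" using flinear_comp qm_isoD(1) \<alpha> \<beta> by blast
  show "bij_betw (\<lambda>x. \<beta> (\<alpha> x)) (fst L) (fst N)"
    using bij_betw_trans[OF qm_isoD(2)[OF \<alpha>] qm_isoD(2)[OF \<beta>]] by (simp add: comp_def)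
  fix V assume V: "V \<in> subspaces (fst L)"
  have "\<alpha> ` V \<in> subspaces (fst M)"
    using subspaces_image[OF qm_isoD(1)[OF \<alpha>] V] qm_isoD(3)[OF \<alpha>] by simp
  then have "snd N (\<beta> ` \<alpha> ` V) = snd L V" using qm_isoD(5)[OF \<alpha> V] qm_isoD(5)[OF \<beta>] by simp
  then show "snd N ((\<lambda>x. \<beta> (\<alpha> x)) ` V) = snd L V" by (simp add: image_image)
qed

lemma qm_iso_inverse:
  assumes \<alpha>: "qm_iso \<alpha> M N" and M: "fv.subspace (fst M)"
  obtains \<beta> where "qm_iso \<beta> N M"
proof -
  note a = qm_isoD[OF \<alpha>]
  obtain \<beta> where \<beta>: "flinear \<beta>" "\<And>x. x \<in> fst M \<Longrightarrow> \<beta> (\<alpha> x) = x"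
    using fvp.linear_exists_left_inverse_on[OF a(1) M a(4)] by blast
  have \<beta>': "\<beta> y \<in> fst M" "\<alpha> (\<beta> y) = y" if "y \<in> fst N" for y
    using that \<beta>(2) unfolding a(3)[symmetric] by auto
  have "qm_iso \<beta> N M"
    unfolding qm_iso_def
  proof (intro conjI ballI)
    show "bij_betw \<beta> (fst N) (fst M)"
      by (rule bij_betw_byWitness[where f' = \<alpha>]) (use \<beta> \<beta>' a(3) in auto)
    fix V assume V: "V \<in> subspaces (fst N)"
    then have "\<alpha> ` \<beta> ` V = V" using \<beta>'(2) by (force simp: subspaces_def image_image)
    moreover have "\<beta> ` V \<in> subspaces (fst M)"
      using V \<beta>' fvp.linear_subspace_image[OF \<beta>(1)] by (auto simp: subspaces_def)
    ultimately show "snd M (\<beta> ` V) = snd N V" using a(5) by metis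
  qed (rule \<beta>(1))
  then show ?thesis using that by blast
qed

lemma qm_equiv_refl: "qm_equiv M M"
  using qm_equiv_if_iso qm_iso_id .

lemma qm_equiv_sym:
  assumes "qm_equiv M N" and M: "fv.subspace (fst M)"
  shows "qm_equiv N M"
proof -
  obtain \<alpha> where \<alpha>: "qm_iso \<alpha> M N" using qm_equiv_imp_iso[OF assms] .
  obtain \<beta> where "qm_iso \<beta> N M" using qm_iso_inverse[OF \<alpha> M] .
  then show ?thesis by (rule qm_equiv_if_iso)
qed

lemma qm_equiv_trans:
  assumes "qm_equiv L M" "qm_equiv M N" "fv.subspace (fst L)" "fv.subspace (fst M)"
  shows "qm_equiv L N"
proof -
  obtain \<alpha> \<beta> where "qm_iso \<alpha> L M" "qm_iso \<beta> M N" using qm_equiv_imp_iso assms by meson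
  then have "qm_iso (\<lambda>x. \<beta> (\<alpha> x)) L N" by (rule qm_iso_comp)
  then show ?thesis by (rule qm_equiv_if_iso)
qed

lemma qm_equiv_zero_iff:
  assumes "qm_equiv M N" and M: "fv.subspace (fst M)"
  shows "fst M = {0} \<longleftrightarrow> fst N = {0}"
proof -
  obtain \<alpha> where "qm_iso \<alpha> M N" using qm_equiv_imp_iso[OF assms] .
  note a = qm_isoD[OF this]
  have zero: "\<alpha> 0 = 0" using fvp.linear_0[OF a(1)] .
  have "fst M = {0}" if "fst N = {0}"
  proof -
    have "x = 0" if "x \<in> fst M" for x
      using that \<open>fst N = {0}\<close> a(3) zero inj_onD[OF a(4), of x 0] fv.subspace_0[OF M] by auto
    then show ?thesis using fv.subspace_0[OF M] by blast
  qed
  moreover have "fst N = {0}" if "fst M = {0}" using that a(3) zero by simp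
  ultimately show ?thesis by blast
qed

lemma qm_equiv_dim_eq:
  assumes "qm_equiv M N" "fv.subspace (fst M)" shows "fv.dim (fst M) = fv.dim (fst N)"
proof -
  obtain \<alpha> where "qm_iso \<alpha> M N" using qm_equiv_imp_iso[OF assms] .
  from qm_isoD(1,3,4)[OF this] show ?thesis using fvp.dim_image_inj_on assms(2) by metis
qed

section \<open>The rank function of a direct sum\<close>

lemma subspaces_image_eq:
  assumes f: "flinear f" and V: "fv.subspace V"
  shows "subspaces (f ` V) = (`) f ` subspaces V"
proof
  show "(`) f ` subspaces V \<subseteq> subspaces (f ` V)" using subspaces_image[OF f] by blast
  show "subspaces (f ` V) \<subseteq> (`) f ` subspaces V"
  proof
    fix Y assume Y: "Y \<in> subspaces (f ` V)"
    let ?X = "V \<inter> {x. f x \<in> Y}"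
    have "?X \<in> subspaces V"
      using Y V fvp.linear_subspace_linear_preimage[OF f]
      by (simp add: subspaces_def fv.subspace_inter)
    moreover have "Y = f ` ?X" using Y by (auto simp: subspaces_def)
    ultimately show "Y \<in> (`) f ` subspaces V" by blast
  qed
qed

lemma ds_rank_image:
  assumes \<alpha>: "flinear \<alpha>" and V: "fv.subspace V" "inj_on \<alpha> V"
  shows "ds_rank p1 p2 \<rho>1 \<rho>2 (\<alpha> ` V) = ds_rank (\<lambda>x. p1 (\<alpha> x)) (\<lambda>x. p2 (\<alpha> x)) \<rho>1 \<rho>2 V"
proof -
  have "fv.dim (\<alpha> ` X) = fv.dim X" if "X \<in> subspaces V" for X
    using that fvp.dim_image_inj_on[OF \<alpha>] inj_on_subset[OF V(2)] by (simp add: subspaces_def)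
  moreover have "V \<in> subspaces V" using V by (simp add: subspaces_def)
  ultimately show ?thesis
    unfolding ds_rank_def Setcompr_eq_image subspaces_image_eq[OF \<alpha> V(1)] image_image
    by (simp cong: image_cong)
qed

lemma ds_rank_cong:
  assumes "\<And>X. X \<in> subspaces V \<Longrightarrow> \<rho>1 (f ` X) = \<rho>1' (f' ` X)"
    "\<And>X. X \<in> subspaces V \<Longrightarrow> \<rho>2 (g ` X) = \<rho>2' (g' ` X)"
  shows "ds_rank f g \<rho>1 \<rho>2 V = ds_rank f' g' \<rho>1' \<rho>2' V"
  unfolding ds_rank_def Setcompr_eq_image using assms by (simp cong: image_cong)

lemma ds_rank_commute: "ds_rank g f \<rho>2 \<rho>1 V = ds_rank f g \<rho>1 \<rho>2 V"
  by (simp add: ds_rank_def add.commute)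

locale q_matroid_pair = M1: q_matroid E1 \<rho>1 + M2: q_matroid E2 \<rho>2
  for E1 :: "(nat \<Rightarrow> 'f::field) set" and \<rho>1 and E2 :: "(nat \<Rightarrow> 'f) set" and \<rho>2 +
  fixes E :: "(nat \<Rightarrow> 'f) set" and f g :: "(nat \<Rightarrow> 'f) \<Rightarrow> (nat \<Rightarrow> 'f)"
  assumes subspace: "fv.subspace E" and fin_dim: "fv.fin_dim E"
    and linear: "flinear f" "flinear g" and closed: "f ` E \<subseteq> E1" "g ` E \<subseteq> E2"
begin

abbreviation rank_sum :: "(nat \<Rightarrow> 'f) set \<Rightarrow> nat" where
  "rank_sum X \<equiv> \<rho>1 (f ` X) + \<rho>2 (g ` X)"

abbreviation ds :: "(nat \<Rightarrow> 'f) set \<Rightarrow> nat" where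
  "ds \<equiv> ds_rank f g \<rho>1 \<rho>2"

lemma mem_subspacesD: "V \<in> subspaces E \<Longrightarrow> fv.subspace V" "V \<in> subspaces E \<Longrightarrow> fv.fin_dim V"
  using fv.fin_dim_subset[OF fin_dim] by (auto simp: subspaces_def)

lemma image_mem:
  assumes "V \<in> subspaces E" shows "f ` V \<in> subspaces E1" "g ` V \<in> subspaces E2"
  using subspaces_trans[OF subspaces_image[OF linear(1) assms] closed(1)]
    subspaces_trans[OF subspaces_image[OF linear(2) assms] closed(2)] .

lemma dim_mono: "X \<in> subspaces V \<Longrightarrow> V \<in> subspaces E \<Longrightarrow> fv.dim X \<le> fv.dim V"
  by (rule fv.dim_le_if_subset) (auto simp: mem_subspacesD subspaces_def[of V])

lemma rank_sum_mono:
  assumes "V \<in> subspaces E" "W \<in> subspaces E" "V \<subseteq> W"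
  shows "rank_sum V \<le> rank_sum W"
  using M1.rank_mono[OF image_mem(1) image_mem(1)] M2.rank_mono[OF image_mem(2) image_mem(2)] assms
  by (intro add_mono) (simp_all add: image_mono)

lemma rank_sum_submodular:
  assumes V: "V \<in> subspaces E" and W: "W \<in> subspaces E"
  shows "rank_sum (fv.span (V \<union> W)) + rank_sum (V \<inter> W) \<le> rank_sum V + rank_sum W"
proof -
  have VW: "V \<inter> W \<in> subspaces E" using V W by (auto simp: subspaces_def fv.subspace_inter)
  have image: "h ` fv.span (V \<union> W) = fv.span (h ` V \<union> h ` W)" if "flinear h" for h
    using fvp.linear_span_image[OF that, of "V \<union> W"] by (simp add: image_Un)
  have "\<rho>1 (f ` (V \<inter> W)) \<le> \<rho>1 (f ` V \<inter> f ` W)" "\<rho>2 (g ` (V \<inter> W)) \<le> \<rho>2 (g ` V \<inter> g ` W)"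
    using image_mem[OF V] image_mem[OF W] image_mem[OF VW]
    by (auto intro!: M1.rank_mono M2.rank_mono M1.Int_mem M2.Int_mem)
  then show ?thesis
    using M1.rank_submodular[OF image_mem(1)[OF V] image_mem(1)[OF W]]
      M2.rank_submodular[OF image_mem(2)[OF V] image_mem(2)[OF W]]
    unfolding image[OF linear(1)] image[OF linear(2)] by linarith
qed

lemma finite_ds_candidates:
  assumes "V \<in> subspaces E"
  shows "finite {int (\<rho>1 (f ` X)) + int (\<rho>2 (g ` X)) - int (fv.dim X) | X. X \<in> subspaces V}"
proof (rule finite_subset)
  have "rank_sum X \<le> rank_sum V" "fv.dim X \<le> fv.dim V" if "X \<in> subspaces V" for X
    using that assms dim_mono by (auto intro!: rank_sum_mono simp: subspaces_def)
  then show "{int (\<rho>1 (f ` X)) + int (\<rho>2 (g ` X)) - int (fv.dim X) | X. X \<in> subspaces V}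
    \<subseteq> {- int (fv.dim V)..int (rank_sum V)}" by fastforce
qed simp

lemma ds_rank_attained:
  assumes V: "V \<in> subspaces E"
  obtains X where "X \<in> subspaces V" "ds V + fv.dim X = rank_sum X + fv.dim V"
proof -
  let ?S = "{int (\<rho>1 (f ` X)) + int (\<rho>2 (g ` X)) - int (fv.dim X) | X. X \<in> subspaces V}"
  have "?S \<noteq> {}" using V by (auto simp: subspaces_def)
  then have "Min ?S \<in> ?S" by (rule Min_in[OF finite_ds_candidates[OF V]])
  then obtain X where X: "X \<in> subspaces V"
    "Min ?S = int (\<rho>1 (f ` X)) + int (\<rho>2 (g ` X)) - int (fv.dim X)" by blast
  then show ?thesis using that[of X] dim_mono[OF X(1) V] by (simp add: ds_rank_def)
qed

lemma ds_rank_le: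
  assumes X: "X \<in> subspaces V" and V: "V \<in> subspaces E"
  shows "ds V + fv.dim X \<le> rank_sum X + fv.dim V"
proof -
  let ?S = "{int (\<rho>1 (f ` X)) + int (\<rho>2 (g ` X)) - int (fv.dim X) | X. X \<in> subspaces V}"
  have "Min ?S \<le> int (\<rho>1 (f ` X)) + int (\<rho>2 (g ` X)) - int (fv.dim X)"
    using X by (intro Min_le finite_ds_candidates[OF V]) auto
  then show ?thesis using dim_mono[OF X V] by (simp add: ds_rank_def)
qed

lemma ds_rank_le_dim:
  assumes V: "V \<in> subspaces E" shows "ds V \<le> fv.dim V"
proof -
  have "{0} \<in> subspaces V" using mem_subspacesD(1)[OF V] fv.subspace_0 by (auto simp: subspaces_def)
  moreover have "f ` {0} = {0}" "g ` {0} = {0}" using linear fvp.linear_0 by auto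
  ultimately show ?thesis using ds_rank_le[of "{0}", OF _ V] M1.rank_zero M2.rank_zero by simp
qed

lemma ds_rank_mono:
  assumes V: "V \<in> subspaces E" and W: "W \<in> subspaces E" and VW: "V \<subseteq> W"
  shows "ds V \<le> ds W"
proof -
  obtain X where X: "X \<in> subspaces W" "ds W + fv.dim X = rank_sum X + fv.dim W"
    using ds_rank_attained[OF W] .
  have XE: "X \<in> subspaces E" using X W by (auto simp: subspaces_def)
  have XV: "X \<inter> V \<in> subspaces V" "X \<inter> V \<in> subspaces E"
    using XE V by (auto simp: subspaces_def fv.subspace_inter)
  have "ds V + fv.dim (X \<inter> V) \<le> rank_sum (X \<inter> V) + fv.dim V" using ds_rank_le[OF XV(1) V] .
  also have "rank_sum (X \<inter> V) \<le> rank_sum X" using rank_sum_mono XV XE by blast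
  finally have "ds V + fv.dim (X \<inter> V) \<le> rank_sum X + fv.dim V" by simp
  moreover have "fv.dim (fv.span (X \<union> V)) + fv.dim (X \<inter> V) = fv.dim X + fv.dim V"
    using fv.dim_span_Un_Int[OF mem_subspacesD[OF XE] mem_subspacesD[OF V]] .
  moreover have "fv.dim (fv.span (X \<union> V)) \<le> fv.dim W"
  proof (rule dim_mono[OF _ W])
    show "fv.span (X \<union> V) \<in> subspaces W"
      using X(1) VW fv.span_minimal[of "X \<union> V" W] mem_subspacesD(1)[OF W] by (simp add: subspaces_def)
  qed
  ultimately show ?thesis using X(2) by linarith
qed

lemma ds_rank_submodular:
  assumes V: "V \<in> subspaces E" and W: "W \<in> subspaces E"
  shows "ds (fv.span (V \<union> W)) + ds (V \<inter> W) \<le> ds V + ds W"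
proof -
  obtain X where X: "X \<in> subspaces V" "ds V + fv.dim X = rank_sum X + fv.dim V"
    using ds_rank_attained[OF V] .
  obtain Y where Y: "Y \<in> subspaces W" "ds W + fv.dim Y = rank_sum Y + fv.dim W"
    using ds_rank_attained[OF W] .
  have XE: "X \<in> subspaces E" and YE: "Y \<in> subspaces E" using X Y V W by (auto simp: subspaces_def)
  have "fv.span (V \<union> W) \<in> subspaces E"
    using V W fv.span_minimal[of "V \<union> W" E] subspace by (simp add: subspaces_def)
  moreover have "fv.span (X \<union> Y) \<in> subspaces (fv.span (V \<union> W))"
    using X(1) Y(1) fv.span_mono[of "X \<union> Y" "V \<union> W"] by (auto simp: subspaces_def)
  ultimately have "ds (fv.span (V \<union> W)) + fv.dim (fv.span (X \<union> Y))
      \<le> rank_sum (fv.span (X \<union> Y)) + fv.dim (fv.span (V \<union> W))"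
    by (intro ds_rank_le)
  moreover have "ds (V \<inter> W) + fv.dim (X \<inter> Y) \<le> rank_sum (X \<inter> Y) + fv.dim (V \<inter> W)"
    using V W X(1) Y(1) by (intro ds_rank_le) (auto simp: subspaces_def fv.subspace_inter)
  moreover have "rank_sum (fv.span (X \<union> Y)) + rank_sum (X \<inter> Y) \<le> rank_sum X + rank_sum Y"
    using rank_sum_submodular[OF XE YE] .
  moreover have "fv.dim (fv.span (X \<union> Y)) + fv.dim (X \<inter> Y) = fv.dim X + fv.dim Y"
    using fv.dim_span_Un_Int[OF mem_subspacesD[OF XE] mem_subspacesD[OF YE]] .
  moreover have "fv.dim (fv.span (V \<union> W)) + fv.dim (V \<inter> W) = fv.dim V + fv.dim W"
    using fv.dim_span_Un_Int[OF mem_subspacesD[OF V] mem_subspacesD[OF W]] .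
  ultimately show ?thesis using X(2) Y(2) by linarith
qed

lemma qmatroid_ds_rank: "qmatroid (E, ds)"
  by (rule qmatroidI) (fact subspace fin_dim ds_rank_le_dim ds_rank_mono ds_rank_submodular)+

lemma ds_rank_eq_left:
  assumes V: "V \<in> subspaces E" and f: "inj_on f V" and g: "\<And>x. x \<in> V \<Longrightarrow> g x = 0"
  shows "ds V = \<rho>1 (f ` V)"
proof (rule antisym)
  have VV: "V \<in> subspaces V" using mem_subspacesD(1)[OF V] by (simp add: subspaces_def)
  have g0: "\<rho>2 (g ` X) = 0" if "X \<in> subspaces V" for X
  proof -
    have "g ` X = {0}" using that g fv.subspace_0[of X] by (force simp: subspaces_def)
    then show ?thesis using M2.rank_zero by simp
  qed
  show "ds V \<le> \<rho>1 (f ` V)" using ds_rank_le[OF VV V] g0[OF VV] by simp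
  obtain X where X: "X \<in> subspaces V" "ds V + fv.dim X = rank_sum X + fv.dim V"
    using ds_rank_attained[OF V] .
  have dim: "fv.dim (f ` Y) = fv.dim Y" if "Y \<in> subspaces V" for Y
    using that fvp.dim_image_inj_on[OF linear(1)] inj_on_subset[OF f] by (simp add: subspaces_def)
  have "\<rho>1 (f ` V) + fv.dim (f ` X) \<le> \<rho>1 (f ` X) + fv.dim (f ` V)"
    using X(1) V by (intro M1.rank_add_dim_le image_mem) (auto simp: subspaces_def)
  then show "\<rho>1 (f ` V) \<le> ds V" using X(2) dim[OF X(1)] dim[OF VV] g0[OF X(1)] by linarith
qed

end

section \<open>Direct sums of two q-matroids\<close>

definition is_direct_sum ::
  "(nat \<Rightarrow> 'f::field) set \<Rightarrow> ((nat \<Rightarrow> 'f) set \<Rightarrow> nat) \<Rightarrow> ((nat \<Rightarrow> 'f) \<Rightarrow> (nat \<Rightarrow> 'f)) \<Rightarrow>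
   ((nat \<Rightarrow> 'f) \<Rightarrow> (nat \<Rightarrow> 'f)) \<Rightarrow> 'f qm \<Rightarrow> 'f qm \<Rightarrow> bool" where
  "is_direct_sum E \<rho> f g A B \<longleftrightarrow> flinear f \<and> flinear g \<and>
     bij_betw (\<lambda>x. (f x, g x)) E (fst A \<times> fst B) \<and>
     (\<forall>V\<in>subspaces E. \<rho> V = ds_rank f g (snd A) (snd B) V)"

lemma is_direct_sum_commute:
  assumes "is_direct_sum E \<rho> f g A B" shows "is_direct_sum E \<rho> g f B A"
proof -
  have "bij_betw (prod.swap \<circ> (\<lambda>x. (f x, g x))) E (fst B \<times> fst A)"
    using assms
    by (intro bij_betw_trans[of _ E "fst A \<times> fst B"]) (auto simp: is_direct_sum_def bij_betw_def)
  then show ?thesis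
    using assms by (simp add: is_direct_sum_def comp_def ds_rank_commute[of g f])
qed

lemma evp_interleave [simp]: "evp (interleave u v) = u"
  and odp_interleave [simp]: "odp (interleave u v) = v"
  by (auto simp: evp_def odp_def interleave_def)

lemma interleave_eq_iff: "interleave u v = interleave u' v' \<longleftrightarrow> u = u' \<and> v = v'"
  by (metis evp_interleave odp_interleave)

lemma interleave_evp_odp [simp]: "interleave (evp w) (odp w) = w"
  by (auto simp: evp_def odp_def interleave_def fun_eq_iff)

lemma flinear_evp: "flinear evp" and flinear_odp: "flinear odp"
  by (auto simp: Vector_Spaces.linear_iff fv.vector_space_axioms evp_def odp_def fscale_def
      fun_eq_iff plus_fun_apply)

lemma flinear_interleave:
  assumes "flinear f" "flinear g" shows "flinear (\<lambda>x. interleave (f x) (g x))"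
  using assms
  by (auto simp: Vector_Spaces.linear_iff interleave_def fscale_def fun_eq_iff plus_fun_apply)

lemma fst_dsum: "fst (dsum A B) = {w. evp w \<in> fst A \<and> odp w \<in> fst B}"
proof -
  have "w \<in> {interleave u v | u v. u \<in> fst A \<and> v \<in> fst B}" if "evp w \<in> fst A" "odp w \<in> fst B" for w
    using that interleave_evp_odp[of w] by (metis (mono_tags, lifting) mem_Collect_eq)
  then show ?thesis by (auto simp: dsum_def split: prod.splits)
qed

lemma snd_dsum: "snd (dsum A B) = ds_rank evp odp (snd A) (snd B)"
  by (auto simp: dsum_def split: prod.splits)

lemma bij_betw_evp_odp: "bij_betw (\<lambda>w. (evp w, odp w)) (fst (dsum A B)) (fst A \<times> fst B)"
  and bij_betw_interleave: "bij_betw (\<lambda>(u, v). interleave u v) (fst A \<times> fst B) (fst (dsum A B))"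
  by (auto simp: fst_dsum intro!: bij_betw_byWitness[where f' = "\<lambda>(u, v). interleave u v"]
      bij_betw_byWitness[where f' = "\<lambda>w. (evp w, odp w)"])

lemma qmatroid_dsum:
  assumes "qmatroid A" "qmatroid B"
  shows "qmatroid (dsum A B)"
proof -
  interpret A: q_matroid "fst A" "snd A" using assms by unfold_locales simp
  interpret B: q_matroid "fst B" "snd B" using assms by unfold_locales simp
  let ?E = "fst (dsum A B)"
  let ?\<iota>1 = "\<lambda>u. interleave u 0" and ?\<iota>2 = "\<lambda>v. interleave 0 v"
  have "fv.subspace ?E"
    unfolding fst_dsum Collect_conj_eq
    by (intro fv.subspace_inter fvp.linear_subspace_linear_preimage flinear_evp flinear_odp
        A.subspace_ground B.subspace_ground)
  moreover have "flinear ?\<iota>1" "flinear ?\<iota>2"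
    using flinear_interleave[OF fv.linear_ident fvp.linear_zero]
      flinear_interleave[OF fvp.linear_zero fv.linear_ident] by simp_all
  then have "fv.fin_dim (?\<iota>1 ` fst A)" "fv.fin_dim (?\<iota>2 ` fst B)"
    using fvp.fin_dim_image A.fin_dim_ground B.fin_dim_ground by blast+
  then have "fv.fin_dim (fv.span (?\<iota>1 ` fst A \<union> ?\<iota>2 ` fst B))" by (rule fv.fin_dim_span_Un)
  then have "fv.fin_dim ?E"
  proof (rule fv.fin_dim_subset)
    show "?E \<subseteq> fv.span (?\<iota>1 ` fst A \<union> ?\<iota>2 ` fst B)"
    proof
      fix w assume "w \<in> ?E"
      then have "?\<iota>1 (evp w) + ?\<iota>2 (odp w) \<in> fv.span (?\<iota>1 ` fst A \<union> ?\<iota>2 ` fst B)"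
        by (intro fv.span_add fv.span_base) (auto simp: fst_dsum)
      moreover have "?\<iota>1 (evp w) + ?\<iota>2 (odp w) = interleave (evp w) (odp w)"
        by (auto simp: interleave_def fun_eq_iff plus_fun_apply zero_fun_apply)
      ultimately show "w \<in> fv.span (?\<iota>1 ` fst A \<union> ?\<iota>2 ` fst B)" by simp
    qed
  qed
  ultimately have "q_matroid_pair (fst A) (snd A) (fst B) (snd B) ?E evp odp"
    by (intro q_matroid_pair.intro q_matroid_pair_axioms.intro A.q_matroid_axioms B.q_matroid_axioms
        flinear_evp flinear_odp) (auto simp: fst_dsum)
  from q_matroid_pair.qmatroid_ds_rank[OF this] show ?thesis by (simp flip: snd_dsum)
qed

lemma qmatroid_dsum_list:
  assumes "Ms \<noteq> []" "\<forall>N\<in>set Ms. qmatroid N"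
  shows "qmatroid (dsum_list Ms)"
  using assms by (induction Ms rule: dsum_list.induct) (auto intro: qmatroid_dsum)

lemma qm_equiv_dsum_iff_is_direct_sum:
  assumes E: "fv.subspace E"
  shows "qm_equiv (E, \<rho>) (dsum A B) \<longleftrightarrow> (\<exists>f g. is_direct_sum E \<rho> f g A B)"
proof
  assume "qm_equiv (E, \<rho>) (dsum A B)"
  then obtain \<alpha> where \<alpha>: "qm_iso \<alpha> (E, \<rho>) (dsum A B)" using qm_equiv_imp_iso E by (metis fst_conv)
  note a = qm_isoD[OF \<alpha>, unfolded fst_conv snd_conv]
  have "bij_betw (\<lambda>x. (evp (\<alpha> x), odp (\<alpha> x))) E (fst A \<times> fst B)"
    using bij_betw_trans[OF a(2) bij_betw_evp_odp] by (simp add: comp_def)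
  moreover have "\<rho> V = ds_rank (\<lambda>x. evp (\<alpha> x)) (\<lambda>x. odp (\<alpha> x)) (snd A) (snd B) V"
    if "V \<in> subspaces E" for V
    using a(5)[OF that] ds_rank_image[OF a(1), of V] inj_on_subset[OF a(4), of V] that
    by (simp add: snd_dsum subspaces_def)
  ultimately show "\<exists>f g. is_direct_sum E \<rho> f g A B"
    using flinear_comp[OF a(1) flinear_evp] flinear_comp[OF a(1) flinear_odp]
    unfolding is_direct_sum_def by blast
next
  assume "\<exists>f g. is_direct_sum E \<rho> f g A B"
  then obtain f g where s: "flinear f" "flinear g" "bij_betw (\<lambda>x. (f x, g x)) E (fst A \<times> fst B)"
    "\<And>V. V \<in> subspaces E \<Longrightarrow> \<rho> V = ds_rank f g (snd A) (snd B) V"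
    unfolding is_direct_sum_def by blast
  let ?\<alpha> = "\<lambda>x. interleave (f x) (g x)"
  have lin: "flinear ?\<alpha>" using flinear_interleave s(1,2) .
  have bij: "bij_betw ?\<alpha> E (fst (dsum A B))"
    using bij_betw_trans[OF s(3) bij_betw_interleave] by (simp add: comp_def)
  have "snd (dsum A B) (?\<alpha> ` V) = \<rho> V" if "V \<in> subspaces E" for V
    using s(4)[OF that] ds_rank_image[OF lin, of V] inj_on_subset[of ?\<alpha> E V] bij that
    by (simp add: snd_dsum subspaces_def bij_betw_def)
  then have "qm_iso ?\<alpha> (E, \<rho>) (dsum A B)" using bij lin by (simp add: qm_iso_def)
  then show "qm_equiv (E, \<rho>) (dsum A B)" by (rule qm_equiv_if_iso)
qed

section \<open>Direct sum projections\<close>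

definition idempotent_on ::
  "(nat \<Rightarrow> 'f::field) set \<Rightarrow> ((nat \<Rightarrow> 'f) \<Rightarrow> (nat \<Rightarrow> 'f)) \<Rightarrow> bool" where
  "idempotent_on E e \<longleftrightarrow> flinear e \<and> e ` E \<subseteq> E \<and> (\<forall>x\<in>E. e (e x) = e x)"

abbreviation compl :: "((nat \<Rightarrow> 'f::field) \<Rightarrow> (nat \<Rightarrow> 'f)) \<Rightarrow> (nat \<Rightarrow> 'f) \<Rightarrow> (nat \<Rightarrow> 'f)" where
  "compl e \<equiv> \<lambda>x. x - e x"

lemma flinear_compl: "flinear e \<Longrightarrow> flinear (compl e)"
  using fvp.linear_compose_sub[OF fv.linear_ident] .

lemma idempotent_onD:
  assumes "idempotent_on E e"
  shows "flinear e" "x \<in> E \<Longrightarrow> e x \<in> E" "x \<in> E \<Longrightarrow> e (e x) = e x" "x \<in> E \<Longrightarrow> e (x - e x) = 0"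
  using assms fvp.linear_diff[of e] by (auto simp: idempotent_on_def)

lemma idempotent_on_fixed: "idempotent_on E e \<Longrightarrow> x \<in> e ` E \<Longrightarrow> e x = x"
  by (auto simp: idempotent_on_def)

lemma idempotent_on_compl:
  assumes "idempotent_on E e" "fv.subspace E" shows "idempotent_on E (compl e)"
  using assms flinear_compl[of e] fvp.linear_diff[of e]
  by (auto simp: idempotent_on_def intro!: fv.subspace_diff)

lemma bij_betw_idempotent:
  assumes e: "idempotent_on E e" and E: "fv.subspace E"
  shows "bij_betw (\<lambda>x. (e x, x - e x)) E (e ` E \<times> compl e ` E)"
proof (rule bij_betw_byWitness[where f' = "\<lambda>(a, b). a + b"])
  show "\<forall>p\<in>e ` E \<times> compl e ` E. (\<lambda>x. (e x, x - e x)) (case p of (a, b) \<Rightarrow> a + b) = p"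
    using idempotent_onD(3,4)[OF e] by (auto simp: fvp.linear_add[OF idempotent_onD(1)[OF e]])
  show "(\<lambda>(a, b). a + b) ` (e ` E \<times> compl e ` E) \<subseteq> E"
    using idempotent_onD(2)[OF e] E by (auto intro!: fv.subspace_add fv.subspace_diff)
qed auto

lemma idempotent_internal_direct_sum:
  assumes e: "idempotent_on E e" and E: "fv.subspace E"
  shows "e ` E \<inter> compl e ` E = {0}" "fv.span (e ` E \<union> compl e ` E) = E"
proof -
  note idem = idempotent_onD[OF e]
  have "a = 0" if a: "a \<in> e ` E" "a \<in> compl e ` E" for a
  proof -
    have "e a = 0" using a(2) idem(4) by blast
    then show ?thesis using idempotent_on_fixed[OF e a(1)] by simp
  qed
  moreover have "0 \<in> e ` E" "0 \<in> compl e ` E"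
    using fv.subspace_0[OF E] fvp.linear_0[OF idem(1)] by (auto simp: image_iff intro: bexI[of _ 0])
  ultimately show "e ` E \<inter> compl e ` E = {0}" by blast
  show "fv.span (e ` E \<union> compl e ` E) = E"
  proof
    show "fv.span (e ` E \<union> compl e ` E) \<subseteq> E"
      using idem(2) E by (intro fv.span_minimal) (auto intro: fv.subspace_diff)
    show "E \<subseteq> fv.span (e ` E \<union> compl e ` E)"
    proof
      fix x assume "x \<in> E"
      then have "e x + (x - e x) \<in> fv.span (e ` E \<union> compl e ` E)"
        by (intro fv.span_add fv.span_base) auto
      then show "x \<in> fv.span (e ` E \<union> compl e ` E)" by simp
    qed
  qed
qed

lemma exists_component_projection:
  assumes lin: "flinear f" "flinear g" and E: "fv.subspace E"
    and bij: "bij_betw (\<lambda>x. (f x, g x)) E (A \<times> B)" and "0 \<in> B"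
  obtains e where "idempotent_on E e" "\<And>x. x \<in> E \<Longrightarrow> f (e x) = f x" "\<And>x. x \<in> E \<Longrightarrow> g (e x) = 0"
proof -
  let ?h = "\<lambda>x. interleave (f x) (g x)"
  have h: "flinear ?h" using flinear_interleave[OF lin] .
  have "inj_on ?h E" using bij by (auto simp: bij_betw_def inj_on_def interleave_eq_iff)
  then obtain k where k: "flinear k" "\<And>x. x \<in> E \<Longrightarrow> k (?h x) = x"
    using fvp.linear_exists_left_inverse_on[OF h E] by blast
  let ?e = "\<lambda>x. k (interleave (f x) 0)"
  have e: "?e x \<in> E \<and> f (?e x) = f x \<and> g (?e x) = 0" if "x \<in> E" for x
  proof -
    have "(f x, 0) \<in> (\<lambda>x. (f x, g x)) ` E" using that bij \<open>0 \<in> B\<close> by (auto simp: bij_betw_def)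
    then obtain y where y: "y \<in> E" "f y = f x" "g y = 0" by auto
    then have "?e x = y" using k(2)[OF y(1)] by simp
    then show ?thesis using y by simp
  qed
  moreover have "?e (?e x) = ?e x" if "x \<in> E" for x using e[OF that] by simp
  moreover have "flinear ?e"
    using flinear_comp[OF flinear_interleave[OF lin(1) fvp.linear_zero] k(1)] .
  ultimately show ?thesis by (intro that[of ?e]) (auto simp: idempotent_on_def)
qed

lemma iproj_eq:
  assumes "fv.subspace A" "fv.subspace B" "A \<inter> B = {0}" "u \<in> A" "w - u \<in> B"
  shows "iproj A B w = u"
  unfolding iproj_def
proof (rule the_equality)
  fix u' assume u': "u' \<in> A \<and> w - u' \<in> B"
  have "(w - u) - (w - u') \<in> B" using fv.subspace_diff[OF assms(2,5)] u' by blast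
  then have "u' - u \<in> A \<inter> B" using fv.subspace_diff[OF assms(1)] u' assms(4) by simp
  then show "u' = u" using assms(3) by simp
qed (use assms in simp)

definition direct_sum_projection ::
  "(nat \<Rightarrow> 'f::field) set \<Rightarrow> ((nat \<Rightarrow> 'f) set \<Rightarrow> nat) \<Rightarrow> ((nat \<Rightarrow> 'f) \<Rightarrow> (nat \<Rightarrow> 'f)) \<Rightarrow> bool" where
  "direct_sum_projection E \<rho> e \<longleftrightarrow> idempotent_on E e \<and>
     (\<forall>V\<in>subspaces E. \<rho> V = ds_rank e (compl e) \<rho> \<rho> V)"

lemma direct_sum_projection_idempotent: "direct_sum_projection E \<rho> e \<Longrightarrow> idempotent_on E e"
  by (simp add: direct_sum_projection_def)

context q_matroid
begin

lemma idempotent_image_mem: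
  assumes e: "idempotent_on E e" and V: "V \<in> subspaces E"
  shows "e ` V \<in> subspaces E" "compl e ` V \<in> subspaces E"
proof -
  have "h ` V \<in> subspaces E" if "idempotent_on E h" for h
    using image_mem[OF idempotent_onD(1)[OF that] V] idempotent_onD(2)[OF that] subspacesD(2)[OF V]
    by blast
  then show "e ` V \<in> subspaces E" "compl e ` V \<in> subspaces E"
    using e idempotent_on_compl[OF e subspace_ground] by blast+
qed

lemma idempotent_ground_mem:
  assumes "idempotent_on E e" shows "e ` E \<in> subspaces E" "compl e ` E \<in> subspaces E"
  using idempotent_image_mem[OF assms ground_mem] .

lemma rank_le_idempotent_split:
  assumes "idempotent_on E e" "V \<in> subspaces E"
  shows "\<rho> V \<le> \<rho> (e ` V) + \<rho> (compl e ` V)"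
proof (rule rank_subadditive[OF assms(2) idempotent_image_mem[OF assms]])
  fix x assume "x \<in> V"
  then show "\<exists>a\<in>e ` V. \<exists>b\<in>compl e ` V. x = a + b"
    by (intro bexI[of _ "e x"] bexI[of _ "x - e x"]) auto
qed

lemma q_matroid_pair_idempotent:
  assumes e: "idempotent_on E e"
  shows "q_matroid_pair E \<rho> E \<rho> E e (compl e)"
proof (intro q_matroid_pair.intro q_matroid_pair_axioms.intro)
  show "e ` E \<subseteq> E" "compl e ` E \<subseteq> E" using idempotent_onD(2)[OF e] subspace_ground
    by (auto intro: fv.subspace_diff)
qed (fact q_matroid_axioms subspace_ground fin_dim_ground idempotent_onD(1)[OF e]
  flinear_compl[OF idempotent_onD(1)[OF e]])+

lemma direct_sum_projection_rank_cyclic: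
  assumes e: "direct_sum_projection E \<rho> e" and X: "X \<in> subspaces E" "cyclic \<rho> X"
  shows "\<rho> X = \<rho> (e ` X) + \<rho> (compl e ` X)"
proof -
  note idem = direct_sum_projection_idempotent[OF e]
  interpret q_matroid_pair E \<rho> E \<rho> E e "compl e" using q_matroid_pair_idempotent[OF idem] .
  obtain Y where Y: "Y \<in> subspaces X" "ds X + fv.dim Y = rank_sum Y + fv.dim X"
    using ds_rank_attained[OF X(1)] .
  have YE: "Y \<in> subspaces E" using subspaces_trans[OF Y(1) subspacesD(2)[OF X(1)]] .
  have "ds X = \<rho> X" using e X(1) by (simp add: direct_sum_projection_def)
  then have "nullity \<rho> X \<le> nullity \<rho> Y"
    using Y(2) rank_le_idempotent_split[OF idem YE] nullity_add_rank[OF X(1)]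
      nullity_add_rank[OF YE]
    by linarith
  then have "Y = X" using X(2) Y(1) unfolding cyclic_def by (meson not_le)
  then show ?thesis using Y(2) \<open>ds X = \<rho> X\<close> by simp
qed

text \<open>The cyclic subspaces suffice because every subspace contains one of the same nullity.\<close>
lemma direct_sum_projectionI:
  assumes e: "idempotent_on E e"
    and cyclic: "\<And>X. X \<in> subspaces E \<Longrightarrow> cyclic \<rho> X \<Longrightarrow> \<rho> (e ` X) + \<rho> (compl e ` X) \<le> \<rho> X"
  shows "direct_sum_projection E \<rho> e"
  unfolding direct_sum_projection_def
proof (intro conjI ballI e antisym)
  interpret q_matroid_pair E \<rho> E \<rho> E e "compl e" using q_matroid_pair_idempotent[OF e] .
  fix V assume V: "V \<in> subspaces E"
  obtain X where X: "X \<in> subspaces V" "cyclic \<rho> X" "nullity \<rho> X = nullity \<rho> V"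
    using exists_cyclic[OF V] .
  have XE: "X \<in> subspaces E" using subspaces_trans[OF X(1) subspacesD(2)[OF V]] .
  show "ds V \<le> \<rho> V"
    using ds_rank_le[OF X(1) V] cyclic[OF XE X(2)] X(3) nullity_add_rank[OF V]
      nullity_add_rank[OF XE]
    by linarith
  obtain Y where Y: "Y \<in> subspaces V" "ds V + fv.dim Y = rank_sum Y + fv.dim V"
    using ds_rank_attained[OF V] .
  have YE: "Y \<in> subspaces E" "Y \<subseteq> V" using Y(1) V by (auto simp: subspaces_def)
  show "\<rho> V \<le> ds V"
    using Y(2) rank_le_idempotent_split[OF e YE(1)] rank_add_dim_le[OF YE(1) V YE(2)] by linarith
qed

lemma direct_sum_projection_imp_is_direct_sum:
  assumes e: "direct_sum_projection E \<rho> e"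
    and \<alpha>: "qm_iso \<alpha> (e ` E, \<rho>) A" and \<beta>: "qm_iso \<beta> (compl e ` E, \<rho>) B"
  shows "is_direct_sum E \<rho> (\<lambda>x. \<alpha> (e x)) (\<lambda>x. \<beta> (x - e x)) A B"
  unfolding is_direct_sum_def
proof (intro conjI ballI)
  note idem = direct_sum_projection_idempotent[OF e]
  note a = qm_isoD[OF \<alpha>, unfolded fst_conv snd_conv]
    and b = qm_isoD[OF \<beta>, unfolded fst_conv snd_conv]
  note lin = idempotent_onD(1)[OF idem]
  show "flinear (\<lambda>x. \<alpha> (e x))" "flinear (\<lambda>x. \<beta> (x - e x))"
    using flinear_comp[OF lin a(1)] flinear_comp[OF flinear_compl[OF lin] b(1)] .
  have "bij_betw (map_prod \<alpha> \<beta>) (e ` E \<times> compl e ` E) (fst A \<times> fst B)"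
    using bij_betw_map_prod[OF a(2) b(2)] .
  from bij_betw_trans[OF bij_betw_idempotent[OF idem subspace_ground] this]
  show "bij_betw (\<lambda>x. (\<alpha> (e x), \<beta> (x - e x))) E (fst A \<times> fst B)" by (simp add: comp_def)
  fix V assume V: "V \<in> subspaces E"
  have "ds_rank (\<lambda>x. \<alpha> (e x)) (\<lambda>x. \<beta> (x - e x)) (snd A) (snd B) V = ds_rank e (compl e) \<rho> \<rho> V"
  proof (rule ds_rank_cong)
    fix X assume "X \<in> subspaces V"
    then have "X \<in> subspaces E" using subspaces_trans subspacesD(2)[OF V] by blast
    then have "e ` X \<in> subspaces (e ` E)" "compl e ` X \<in> subspaces (compl e ` E)"
      using subspaces_image[OF lin] subspaces_image[OF flinear_compl[OF lin]] by blast+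
    then show "snd A ((\<lambda>x. \<alpha> (e x)) ` X) = \<rho> (e ` X)"
      "snd B ((\<lambda>x. \<beta> (x - e x)) ` X) = \<rho> (compl e ` X)"
      using a(5) b(5) by (metis image_image)+
  qed
  then show "\<rho> V = ds_rank (\<lambda>x. \<alpha> (e x)) (\<lambda>x. \<beta> (x - e x)) (snd A) (snd B) V"
    using e V by (simp add: direct_sum_projection_def)
qed

lemma is_direct_sum_pair:
  assumes s: "is_direct_sum E \<rho> f g A B" and qm: "qmatroid A" "qmatroid B"
  shows "q_matroid_pair (fst A) (snd A) (fst B) (snd B) E f g"
proof (intro q_matroid_pair.intro q_matroid_pair_axioms.intro)
  show "q_matroid (fst A) (snd A)" "q_matroid (fst B) (snd B)" using qm
    by (simp_all add: q_matroid_def)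
  show "f ` E \<subseteq> fst A" "g ` E \<subseteq> fst B" using s by (auto simp: is_direct_sum_def bij_betw_def)
qed (use s subspace_ground fin_dim_ground in \<open>simp_all add: is_direct_sum_def\<close>)

lemma is_direct_sum_rank_left:
  assumes s: "is_direct_sum E \<rho> f g A B" and qm: "qmatroid A" "qmatroid B"
    and V: "V \<in> subspaces E" and g: "\<And>x. x \<in> V \<Longrightarrow> g x = 0"
  shows "\<rho> V = snd A (f ` V)"
proof -
  interpret q_matroid_pair "fst A" "snd A" "fst B" "snd B" E f g using is_direct_sum_pair[OF s qm] .
  have "inj_on (\<lambda>x. (f x, g x)) V"
    using s inj_on_subset subspacesD(2)[OF V] by (auto simp: is_direct_sum_def bij_betw_def)
  then have "inj_on f V" using g by (auto simp: inj_on_def)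
  then show ?thesis using ds_rank_eq_left[OF V _ g] s V by (simp add: is_direct_sum_def)
qed

lemma is_direct_sum_iso_left:
  assumes s: "is_direct_sum E \<rho> f g A B" and qm: "qmatroid A" "qmatroid B"
    and e: "idempotent_on E e" "\<And>x. x \<in> E \<Longrightarrow> f (e x) = f x" "\<And>x. x \<in> E \<Longrightarrow> g (e x) = 0"
  shows "qm_iso f (e ` E, \<rho>) A"
  unfolding qm_iso_def fst_conv snd_conv
proof (intro conjI ballI)
  interpret q_matroid_pair "fst A" "snd A" "fst B" "snd B" E f g using is_direct_sum_pair[OF s qm] .
  have bij: "bij_betw (\<lambda>x. (f x, g x)) E (fst A \<times> fst B)" using s by (simp add: is_direct_sum_def)
  show "flinear f" by (rule linear(1))
  show "bij_betw f (e ` E) (fst A)"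
    unfolding bij_betw_def
  proof
    show "inj_on f (e ` E)"
    proof (rule inj_onI, clarify)
      fix x y assume xy: "x \<in> E" "y \<in> E" and eq: "f (e x) = f (e y)"
      then show "e x = e y"
        using idempotent_onD(2)[OF e(1)] e(3) bij by (auto simp: bij_betw_def dest: inj_onD)
    qed
    show "f ` e ` E = fst A"
    proof
      show "fst A \<subseteq> f ` e ` E"
      proof
        fix a assume "a \<in> fst A"
        then have "(a, 0) \<in> (\<lambda>x. (f x, g x)) ` E"
          using bij fv.subspace_0[OF M2.subspace_ground] by (simp add: bij_betw_def)
        then obtain x where "x \<in> E" "f x = a" by auto
        then show "a \<in> f ` e ` E" using e(2)[of x] by (metis imageI)
      qed
    qed (use closed(1) idempotent_onD(2)[OF e(1)] in blast)
  qed
  fix V assume V: "V \<in> subspaces (e ` E)"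
  have "V \<in> subspaces E" using subspaces_trans[OF V] idempotent_onD(2)[OF e(1)] by blast
  moreover have "g x = 0" if "x \<in> V" for x using that V e(3) by (auto simp: subspaces_def)
  ultimately show "snd A (f ` V) = \<rho> V" using is_direct_sum_rank_left[OF s qm] by simp
qed

lemma is_direct_sum_imp_projection:
  assumes s: "is_direct_sum E \<rho> f g A B" and qm: "qmatroid A" "qmatroid B"
  obtains e where "direct_sum_projection E \<rho> e" "qm_iso f (e ` E, \<rho>) A"
    "qm_iso g (compl e ` E, \<rho>) B"
proof -
  interpret q_matroid_pair "fst A" "snd A" "fst B" "snd B" E f g using is_direct_sum_pair[OF s qm] .
  have "bij_betw (\<lambda>x. (f x, g x)) E (fst A \<times> fst B)" using s by (simp add: is_direct_sum_def)
  then obtain e where e: "idempotent_on E e" "\<And>x. x \<in> E \<Longrightarrow> f (e x) = f x" "\<And>x. x \<in> E \<Longrightarrow> g (e x) = 0"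
    using exists_component_projection[OF linear subspace _ fv.subspace_0[OF M2.subspace_ground]]
    by blast
  have e': "g (x - e x) = g x" "f (x - e x) = 0" if "x \<in> E" for x
    using e(2,3)[OF that]
    by (simp_all add: fvp.linear_diff[OF linear(1)] fvp.linear_diff[OF linear(2)])
  have f: "qm_iso f (e ` E, \<rho>) A" using is_direct_sum_iso_left[OF s qm e] .
  have g: "qm_iso g (compl e ` E, \<rho>) B"
    by (rule is_direct_sum_iso_left[OF is_direct_sum_commute[OF s] qm(2,1)
          idempotent_on_compl[OF e(1) subspace]]) (fact e')+
  have "\<rho> V = ds_rank e (compl e) \<rho> \<rho> V" if V: "V \<in> subspaces E" for V
  proof -
    have "ds_rank e (compl e) \<rho> \<rho> V = ds_rank f g (snd A) (snd B) V"
    proof (rule ds_rank_cong)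
      fix X assume "X \<in> subspaces V"
      then have X: "X \<in> subspaces E" using subspaces_trans subspacesD(2)[OF V] by blast
      have "e ` X \<in> subspaces (e ` E)" "compl e ` X \<in> subspaces (compl e ` E)"
        using subspaces_image[OF idempotent_onD(1)[OF e(1)] X]
          subspaces_image[OF flinear_compl[OF idempotent_onD(1)[OF e(1)]] X] .
      moreover have "f ` e ` X = f ` X" "g ` compl e ` X = g ` X"
        using e(2) e'(1) subspacesD(2)[OF X] by (force simp: image_image)+
      ultimately show "\<rho> (e ` X) = snd A (f ` X)" "\<rho> (compl e ` X) = snd B (g ` X)"
        using qm_isoD(5)[OF f] qm_isoD(5)[OF g] by (metis fst_conv snd_conv)+
    qed
    then show ?thesis using s V by (simp add: is_direct_sum_def)
  qed
  then have "direct_sum_projection E \<rho> e" using e(1) by (simp add: direct_sum_projection_def)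
  then show ?thesis using that f g by blast
qed

lemma subspace_projection_images:
  assumes "direct_sum_projection E \<rho> e" shows "fv.subspace (e ` E)" "fv.subspace (compl e ` E)"
  using idempotent_ground_mem[OF direct_sum_projection_idempotent[OF assms]]
  by (simp_all add: subspaces_def)

lemma qm_equiv_dsum_iff_projection:
  assumes "qmatroid A" "qmatroid B"
  shows "qm_equiv (E, \<rho>) (dsum A B) \<longleftrightarrow>
    (\<exists>e. direct_sum_projection E \<rho> e \<and> qm_equiv (e ` E, \<rho>) A \<and> qm_equiv (compl e ` E, \<rho>) B)"
  unfolding qm_equiv_dsum_iff_is_direct_sum[OF subspace_ground]
proof
  assume "\<exists>f g. is_direct_sum E \<rho> f g A B"
  then obtain f g where "is_direct_sum E \<rho> f g A B" by blast
  from is_direct_sum_imp_projection[OF this assms] obtain e where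
    "direct_sum_projection E \<rho> e" "qm_iso f (e ` E, \<rho>) A" "qm_iso g (compl e ` E, \<rho>) B" .
  then show "\<exists>e. direct_sum_projection E \<rho> e \<and> qm_equiv (e ` E, \<rho>) A \<and> qm_equiv (compl e ` E, \<rho>) B"
    using qm_equiv_if_iso by blast
next
  assume "\<exists>e. direct_sum_projection E \<rho> e \<and> qm_equiv (e ` E, \<rho>) A \<and> qm_equiv (compl e ` E, \<rho>) B"
  then obtain e where e: "direct_sum_projection E \<rho> e" and
    eq: "qm_equiv (e ` E, \<rho>) A" "qm_equiv (compl e ` E, \<rho>) B" by blast
  obtain \<alpha> \<beta> where "qm_iso \<alpha> (e ` E, \<rho>) A" "qm_iso \<beta> (compl e ` E, \<rho>) B"
    using qm_equiv_imp_iso[OF eq(1)] qm_equiv_imp_iso[OF eq(2)] subspace_projection_images[OF e]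
    by (metis fst_conv)
  then show "\<exists>f g. is_direct_sum E \<rho> f g A B"
    using direct_sum_projection_imp_is_direct_sum[OF e] by blast
qed

lemma qmatroid_projection_images:
  assumes "direct_sum_projection E \<rho> e" shows "qmatroid (e ` E, \<rho>)" "qmatroid (compl e ` E, \<rho>)"
  using q_matroid_restrict idempotent_ground_mem[OF direct_sum_projection_idempotent[OF assms]]
  by (simp_all add: q_matroid_def)

lemma projection_imp_reducible:
  assumes e: "direct_sum_projection E \<rho> e" and nz: "e ` E \<noteq> {0}" "compl e ` E \<noteq> {0}"
  shows "reducible (E, \<rho>)"
proof -
  note idem = direct_sum_projection_idempotent[OF e]
  let ?A = "e ` E" and ?B = "compl e ` E"
  note mem = idempotent_ground_mem[OF idem]
  note sub = subspacesD(1)[OF mem(1)] subspacesD(1)[OF mem(2)]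
  note int = idempotent_internal_direct_sum(1)[OF idem subspace_ground]
    and span = idempotent_internal_direct_sum(2)[OF idem subspace_ground]
  have iproj: "iproj ?A ?B x = e x" "iproj ?B ?A x = x - e x" if "x \<in> E" for x
    using that sub int by (auto intro!: iproj_eq)
  have "\<rho> V = ds_rank (iproj ?A ?B) (iproj ?B ?A) \<rho> \<rho> V" if V: "V \<in> subspaces E" for V
  proof -
    have "ds_rank (iproj ?A ?B) (iproj ?B ?A) \<rho> \<rho> V = ds_rank e (compl e) \<rho> \<rho> V"
      using iproj V
      by (intro ds_rank_cong arg_cong[where f = \<rho>] image_cong) (auto simp: subspaces_def)
    then show ?thesis using e V by (simp add: direct_sum_projection_def)
  qed
  then show ?thesis
    unfolding reducible_def prod.case
    using qmatroid_projection_images[OF e] nz subspacesD(2)[OF mem(1)] subspacesD(2)[OF mem(2)] int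
      span
    by (intro exI[of _ ?A] exI[of _ \<rho>] exI[of _ ?B]) simp
qed

lemma reducible_imp_is_direct_sum:
  assumes "reducible (E, \<rho>)"
  obtains f g A B
    where "qmatroid A" "qmatroid B" "fst A \<noteq> {0}" "fst B \<noteq> {0}" "is_direct_sum E \<rho> f g A B"
proof -
  obtain E1 \<rho>1 E2 \<rho>2 where qm: "qmatroid (E1, \<rho>1)" "qmatroid (E2, \<rho>2)"
    and nz: "E1 \<noteq> {0}" "E2 \<noteq> {0}" and int: "E1 \<inter> E2 = {0}" and span: "fv.span (E1 \<union> E2) = E"
    and rank: "\<And>V. V \<in> subspaces E \<Longrightarrow> \<rho> V = ds_rank (iproj E1 E2) (iproj E2 E1) \<rho>1 \<rho>2 V"
    using assms unfolding reducible_def prod.case by metis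
  interpret A: q_matroid E1 \<rho>1 using qm by unfold_locales
  interpret B: q_matroid E2 \<rho>2 using qm by unfold_locales
  note sub = A.subspace_ground B.subspace_ground
  obtain p where p: "flinear p" "\<And>x. x \<in> E1 \<Longrightarrow> p x = x" "\<And>x. x \<in> E2 \<Longrightarrow> p x = 0"
    using fv.exists_projection_along[OF sub int] by metis
  have E: "E = {u + v | u v. u \<in> E1 \<and> v \<in> E2}" using span fv.span_Un_subspaces[OF sub] by simp
  have p_add: "p (u + v) = u" if "u \<in> E1" "v \<in> E2" for u v
    using p that by (simp add: fvp.linear_add)
  have iproj: "iproj E1 E2 x = p x" "iproj E2 E1 x = x - p x" if "x \<in> E" for x
    using that p_add int by (auto simp: E intro!: iproj_eq sub)
  have "is_direct_sum E \<rho> p (compl p) (E1, \<rho>1) (E2, \<rho>2)"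
    unfolding is_direct_sum_def fst_conv snd_conv
  proof (intro conjI ballI p(1) flinear_compl)
    show "bij_betw (\<lambda>x. (p x, x - p x)) E (E1 \<times> E2)"
      by (rule bij_betw_byWitness[where f' = "\<lambda>(u, v). u + v"]) (auto simp: E p_add)
    fix V assume V: "V \<in> subspaces E"
    have "ds_rank (iproj E1 E2) (iproj E2 E1) \<rho>1 \<rho>2 V = ds_rank p (compl p) \<rho>1 \<rho>2 V"
      using iproj V by (intro ds_rank_cong arg_cong[where f = \<rho>1] arg_cong[where f = \<rho>2] image_cong)
        (auto simp: subspaces_def)
    then show "\<rho> V = ds_rank p (compl p) \<rho>1 \<rho>2 V" using rank[OF V] by simp
  qed
  then show ?thesis using that[of "(E1, \<rho>1)" "(E2, \<rho>2)"] qm nz by simp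
qed

lemma reducible_iff_projection:
  "reducible (E, \<rho>) \<longleftrightarrow> (\<exists>e. direct_sum_projection E \<rho> e \<and> e ` E \<noteq> {0} \<and> compl e ` E \<noteq> {0})"
proof
  assume "reducible (E, \<rho>)"
  from reducible_imp_is_direct_sum[OF this] obtain f g A B where AB: "qmatroid A" "qmatroid B"
    and nz: "fst A \<noteq> {0}" "fst B \<noteq> {0}" and s: "is_direct_sum E \<rho> f g A B" .
  from is_direct_sum_imp_projection[OF s AB] obtain e where e: "direct_sum_projection E \<rho> e"
    "qm_iso f (e ` E, \<rho>) A" "qm_iso g (compl e ` E, \<rho>) B" .
  have "e ` E \<noteq> {0}" "compl e ` E \<noteq> {0}"
    using nz qm_equiv_zero_iff[OF qm_equiv_if_iso[OF e(2)]]
      qm_equiv_zero_iff[OF qm_equiv_if_iso[OF e(3)]]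
      subspace_projection_images[OF e(1)] by simp_all
  then show "\<exists>e. direct_sum_projection E \<rho> e \<and> e ` E \<noteq> {0} \<and> compl e ` E \<noteq> {0}" using e(1) by blast
qed (use projection_imp_reducible in blast)

lemma reducible_iff_equiv_dsum:
  "reducible (E, \<rho>) \<longleftrightarrow>
    (\<exists>A B. qmatroid A \<and> qmatroid B \<and> fst A \<noteq> {0} \<and> fst B \<noteq> {0} \<and> qm_equiv (E, \<rho>) (dsum A B))"
proof
  assume "reducible (E, \<rho>)"
  then show "\<exists>A B. qmatroid A \<and> qmatroid B \<and> fst A \<noteq> {0} \<and> fst B \<noteq> {0} \<and> qm_equiv (E, \<rho>) (dsum A B)"
    using reducible_imp_is_direct_sum qm_equiv_dsum_iff_is_direct_sum[OF subspace_ground] by metis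
next
  assume "\<exists>A B. qmatroid A \<and> qmatroid B \<and> fst A \<noteq> {0} \<and> fst B \<noteq> {0} \<and> qm_equiv (E, \<rho>) (dsum A B)"
  then obtain A B e where nz: "fst A \<noteq> {0}" "fst B \<noteq> {0}" and e: "direct_sum_projection E \<rho> e"
    "qm_equiv (e ` E, \<rho>) A" "qm_equiv (compl e ` E, \<rho>) B"
    using qm_equiv_dsum_iff_projection by blast
  have "e ` E \<noteq> {0}" "compl e ` E \<noteq> {0}"
    using nz qm_equiv_zero_iff[OF e(2)] qm_equiv_zero_iff[OF e(3)]
      subspace_projection_images[OF e(1)]
    by simp_all
  then show "reducible (E, \<rho>)" using projection_imp_reducible[OF e(1)] by blast
qed

end

lemma qm_equiv_irreducible:
  assumes equiv: "qm_equiv M N" and M: "qmatroid M" and N: "irreducible_qm N"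
  shows "irreducible_qm M"
proof -
  interpret M: q_matroid "fst M" "snd M" using M by unfold_locales simp
  interpret N: q_matroid "fst N" "snd N" using N by unfold_locales (simp add: irreducible_qm_def)
  have "reducible N" if red: "reducible M"
  proof -
    obtain A B where AB: "qmatroid A" "qmatroid B" "fst A \<noteq> {0}" "fst B \<noteq> {0}"
      "qm_equiv M (dsum A B)"
      using red M.reducible_iff_equiv_dsum unfolding prod.collapse by blast
    have "qm_equiv N (dsum A B)"
      using qm_equiv_trans[OF qm_equiv_sym[OF equiv] AB(5)] M.subspace_ground N.subspace_ground
      by simp
    then show ?thesis using AB(1-4) N.reducible_iff_equiv_dsum unfolding prod.collapse by blast
  qed
  then show ?thesis using M N by (auto simp: irreducible_qm_def)
qed

section \<open>Existence of a decomposition into irreducibles\<close>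

context q_matroid
begin

lemma irreducible_projection:
  assumes "irreducible_qm (E, \<rho>)" and e: "direct_sum_projection E \<rho> e"
  shows "(\<forall>x\<in>E. e x = 0) \<or> (\<forall>x\<in>E. e x = x)"
proof -
  have "e ` E = {0} \<or> compl e ` E = {0}"
    using assms reducible_iff_projection by (auto simp: irreducible_qm_def)
  then show ?thesis
  proof
    assume "compl e ` E = {0}"
    then have "x - e x = 0" if "x \<in> E" for x using that by blast
    then show ?thesis by simp
  qed blast
qed

lemma projection_cyclic_image:
  assumes e: "direct_sum_projection E \<rho> e" and X: "X \<in> subspaces E" "cyclic \<rho> X"
  shows "cyclic \<rho> (e ` X)" "cyclic \<rho> (compl e ` X)"
proof -
  note idem = direct_sum_projection_idempotent[OF e]
  let ?g = "\<lambda>b. if b then e else compl e"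
  have "cyclic \<rho> (?g k ` X)" for k
  proof (rule cyclic_image[OF X(1), of UNIV])
    show "flinear (?g i)" for i
      using idempotent_onD(1)[OF idem] flinear_compl[of e] by simp
    show "?g i ` X \<subseteq> E" for i
      using subspacesD(2)[OF idempotent_image_mem(1)[OF idem X(1)]]
        subspacesD(2)[OF idempotent_image_mem(2)[OF idem X(1)]] by simp
    show "(\<Sum>i\<in>UNIV. \<rho> (?g i ` X)) \<le> \<rho> X"
      using direct_sum_projection_rank_cyclic[OF e X] by (simp add: UNIV_bool)
  qed (auto simp: UNIV_bool X(2))
  from this[of True] this[of False] show "cyclic \<rho> (e ` X)" "cyclic \<rho> (compl e ` X)" by simp_all
qed

lemma direct_sum_projection_comp:
  assumes e: "direct_sum_projection E \<rho> e" and a: "direct_sum_projection (e ` E) \<rho> a"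
  shows "direct_sum_projection E \<rho> (\<lambda>x. a (e x))"
proof (rule direct_sum_projectionI)
  note idem_e = direct_sum_projection_idempotent[OF e]
    and idem_a = direct_sum_projection_idempotent[OF a]
  note eE = idempotent_ground_mem(1)[OF idem_e]
  interpret R: q_matroid "e ` E" \<rho> using q_matroid_restrict[OF eE] .
  have ae: "a (e x) \<in> e ` E" if "x \<in> E" for x using idempotent_onD(2)[OF idem_a] that by blast
  have "a (e (a (e x))) = a (e x)" if "x \<in> E" for x
    using idempotent_on_fixed[OF idem_e ae[OF that]] idempotent_onD(3)[OF idem_a, of "e x"] that
    by simp
  then show idem: "idempotent_on E (\<lambda>x. a (e x))"
    using flinear_comp[OF idempotent_onD(1)[OF idem_e] idempotent_onD(1)[OF idem_a]] ae
      subspacesD(2)[OF eE]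
    by (auto simp: idempotent_on_def)
  fix X assume X: "X \<in> subspaces E" "cyclic \<rho> X"
  have eX: "e ` X \<in> subspaces (e ` E)" using subspaces_image[OF idempotent_onD(1)[OF idem_e] X(1)] .
  have "\<rho> X = \<rho> (e ` X) + \<rho> (compl e ` X)" using direct_sum_projection_rank_cyclic[OF e X] .
  moreover have "\<rho> (e ` X) = \<rho> (a ` e ` X) + \<rho> (compl a ` e ` X)"
    using R.direct_sum_projection_rank_cyclic[OF a eX projection_cyclic_image(1)[OF e X]] .
  moreover have "\<rho> ((\<lambda>x. x - a (e x)) ` X) \<le> \<rho> (compl a ` e ` X) + \<rho> (compl e ` X)"
  proof (rule rank_subadditive[OF idempotent_image_mem(2)[OF idem X(1)] _
      idempotent_image_mem(2)[OF idem_e X(1)]])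
    show "compl a ` e ` X \<in> subspaces E"
      using R.idempotent_image_mem(2)[OF idem_a eX] subspacesD(2)[OF eE] by (rule subspaces_trans)
    fix z assume "z \<in> (\<lambda>x. x - a (e x)) ` X"
    then obtain x where x: "x \<in> X" "z = x - a (e x)" by blast
    then have "z = (e x - a (e x)) + (x - e x)" by simp
    then show "\<exists>u\<in>compl a ` e ` X. \<exists>v\<in>compl e ` X. z = u + v" using x(1) by blast
  qed
  ultimately show "\<rho> ((\<lambda>x. a (e x)) ` X) + \<rho> ((\<lambda>x. x - a (e x)) ` X) \<le> \<rho> X"
    by (simp add: image_image)
qed

lemma exists_irreducible_projection:
  assumes "reducible (E, \<rho>)"
  obtains e where "direct_sum_projection E \<rho> e" "irreducible_qm (e ` E, \<rho>)" "e ` E \<noteq> {0}"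
proof -
  define P where "P e \<longleftrightarrow> direct_sum_projection E \<rho> e \<and> e ` E \<noteq> {0}" for e
  obtain e0 where "P e0" using assms reducible_iff_projection unfolding P_def by metis
  then obtain e where e: "P e" "\<And>e'. P e' \<Longrightarrow> fv.dim (e ` E) \<le> fv.dim (e' ` E)"
    using arg_min_nat_lemma[of P e0 "\<lambda>e. fv.dim (e ` E)"] by metis
  have proj: "direct_sum_projection E \<rho> e" and nz: "e ` E \<noteq> {0}" using e(1) by (simp_all add: P_def)
  interpret R: q_matroid "e ` E" \<rho>
    using q_matroid_restrict[OF
      idempotent_ground_mem(1)[OF direct_sum_projection_idempotent[OF proj]]] .
  have "\<not> reducible (e ` E, \<rho>)"
  proof
    assume "reducible (e ` E, \<rho>)"
    then obtain a
      where a: "direct_sum_projection (e ` E) \<rho> a" "a ` e ` E \<noteq> {0}" "compl a ` e ` E \<noteq> {0}"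
      using R.reducible_iff_projection by blast
    note idem = direct_sum_projection_idempotent[OF a(1)]
    have "P (\<lambda>x. a (e x))" using direct_sum_projection_comp[OF proj a(1)] a(2)
      by (simp add: P_def image_image)
    then have "fv.dim (e ` E) \<le> fv.dim (a ` e ` E)" using e(2)[of "\<lambda>x. a (e x)"]
      by (simp add: image_image)
    moreover note aeE = R.idempotent_ground_mem(1)[OF idem]
    ultimately have "a ` e ` E = e ` E"
      using fv.dim_less_if_psubset[OF _ R.subspacesD(1)[OF aeE] R.subspace_ground R.fin_dim_ground]
        R.subspacesD(2)[OF aeE] by (metis not_le psubsetI)
    then have "compl a y = 0" if "y \<in> e ` E" for y
      using idempotent_on_fixed[OF idem, of y] that by simp
    moreover have "e ` E \<noteq> {}" using fv.subspace_0[OF R.subspace_ground] by blast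
    ultimately have "compl a ` e ` E = {0}" by (simp add: image_constant_conv cong: image_cong)
    then show False using a(3) by simp
  qed
  then show ?thesis using that proj nz R.qmatroid by (simp add: irreducible_qm_def)
qed

end

lemma dsum_list_Cons: "Ms \<noteq> [] \<Longrightarrow> dsum_list (N # Ms) = dsum N (dsum_list Ms)"
  by (cases Ms) auto

lemma exists_irreducible_dsum_list:
  assumes "qmatroid (E, \<rho>)"
  shows "\<exists>Ms. Ms \<noteq> [] \<and> (\<forall>N\<in>set Ms. irreducible_qm N) \<and> qm_equiv (E, \<rho>) (dsum_list Ms)"
  using assms
proof (induction "fv.dim E" arbitrary: E rule: less_induct)
  case less
  interpret q_matroid E \<rho> using less.prems by unfold_locales
  show ?case
  proof (cases "reducible (E, \<rho>)")
    case False
    then show ?thesis using qmatroid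
      by (intro exI[of _ "[(E, \<rho>)]"]) (simp add: qm_equiv_refl irreducible_qm_def)
  next
    case True
    obtain e where e: "direct_sum_projection E \<rho> e" "irreducible_qm (e ` E, \<rho>)" "e ` E \<noteq> {0}"
      using exists_irreducible_projection[OF True] .
    note idem = direct_sum_projection_idempotent[OF e(1)]
    let ?E = "compl e ` E"
    have "?E \<noteq> E"
    proof
      assume "?E = E"
      then have "e x = 0" if "x \<in> E" for x
        using that idempotent_onD(4)[OF idem] by (metis (no_types, lifting) imageE)
      moreover have "E \<noteq> {}" using fv.subspace_0[OF subspace_ground] by blast
      ultimately show False using e(3) by (simp add: image_constant_conv cong: image_cong)
    qed
    then have "fv.dim ?E < fv.dim E"
      using fv.dim_less_if_psubset[OF _ subspace_projection_images(2)[OF e(1)] subspace_ground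
        fin_dim_ground]
        subspacesD(2)[OF idempotent_ground_mem(2)[OF idem]] by blast
    then obtain Ms
      where Ms: "Ms \<noteq> []" "\<forall>N\<in>set Ms. irreducible_qm N" "qm_equiv (?E, \<rho>) (dsum_list Ms)"
      using less.hyps qmatroid_projection_images(2)[OF e(1)] by blast
    have "qmatroid (dsum_list Ms)" using Ms
      by (intro qmatroid_dsum_list) (auto simp: irreducible_qm_def)
    then have "qm_equiv (E, \<rho>) (dsum (e ` E, \<rho>) (dsum_list Ms))"
      using qm_equiv_dsum_iff_projection[OF qmatroid_projection_images(1)[OF e(1)]] e(1) Ms(3)
        qm_equiv_refl
      by blast
    then show ?thesis using Ms e(2)
      by (intro exI[of _ "(e ` E, \<rho>) # Ms"]) (simp add: dsum_list_Cons)
  qed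
qed

section \<open>Loops and coloops\<close>

context q_matroid
begin

definition loops :: "(nat \<Rightarrow> 'f) set" where
  "loops = {x \<in> E. \<rho> (fv.span {x}) = 0}"

lemma loops_if_rank_zero:
  assumes "x \<in> V" "V \<in> subspaces E" "\<rho> V = 0"
  shows "x \<in> loops"
proof -
  have "x \<in> E" "fv.span {x} \<subseteq> V"
    using assms fv.span_minimal[of "{x}" V] by (auto simp: subspaces_def)
  then show ?thesis
    using rank_mono[OF span_singleton_mem assms(2)] assms(3) by (simp add: loops_def)
qed

lemma subspace_loops: "fv.subspace loops"
proof (rule fv.subspaceI)
  show "0 \<in> loops" using loops_if_rank_zero[OF _ zero_mem] rank_zero by simp
next
  fix x y assume x: "x \<in> loops" and y: "y \<in> loops"
  let ?V = "fv.span (fv.span {x} \<union> fv.span {y})"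
  have mem: "fv.span {x} \<in> subspaces E" "fv.span {y} \<in> subspaces E"
    using x y span_singleton_mem by (simp_all add: loops_def)
  have "\<rho> ?V = 0" using rank_submodular[OF mem] x y by (simp add: loops_def)
  moreover have "x + y \<in> ?V" by (intro fv.span_add) (auto intro!: fv.span_base)
  ultimately show "x + y \<in> loops" using loops_if_rank_zero span_Un_mem[OF mem] by blast
next
  fix c x assume x: "x \<in> loops"
  then have "x \<in> E" "\<rho> (fv.span {x}) = 0" by (simp_all add: loops_def)
  moreover have "fscale c x \<in> fv.span {x}" by (intro fv.span_scale fv.span_base) simp
  ultimately show "fscale c x \<in> loops" using loops_if_rank_zero span_singleton_mem by blast
qed

lemma loops_mem: "loops \<in> subspaces E"
  using subspace_loops by (auto simp: subspaces_def loops_def)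

lemma exists_idempotent_along:
  assumes A: "A \<in> subspaces E" and B: "fv.subspace B" "A \<inter> B = {0}"
  obtains e where "idempotent_on E e" "\<And>x. e x \<in> A" "\<And>x. x \<in> A \<Longrightarrow> e x = x" "\<And>x. x \<in> B \<Longrightarrow> e x = 0"
proof -
  obtain e where e: "flinear e" "\<And>x. e x \<in> A" "\<And>x. x \<in> A \<Longrightarrow> e x = x" "\<And>x. x \<in> B \<Longrightarrow> e x = 0"
    using fv.exists_projection_along[OF subspacesD(1)[OF A] B] by metis
  then have "idempotent_on E e" using subspacesD(2)[OF A] by (auto simp: idempotent_on_def)
  then show ?thesis using that e by blast
qed

lemma irreducible_eq_span_loop:
  assumes irr: "irreducible_qm (E, \<rho>)" and l: "l \<in> loops" "l \<noteq> 0"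
  shows "E = fv.span {l}"
proof -
  have lE: "l \<in> E" and rank_l: "\<rho> (fv.span {l}) = 0" using l(1) by (simp_all add: loops_def)
  note L = span_singleton_mem[OF lE]
  have l_L: "l \<in> fv.span {l}" by (simp add: fv.span_base)
  obtain e where e: "idempotent_on E e" "\<And>x. e x \<in> fv.span {l}" "\<And>x. x \<in> fv.span {l} \<Longrightarrow> e x = x"
    using exists_idempotent_along[OF L fv.subspace_single_0] fv.span_zero[of "{l}"]
    by (metis Int_insert_right_if1 Int_empty_right)
  have "direct_sum_projection E \<rho> e"
  proof (rule direct_sum_projectionI[OF e(1)])
    fix X assume X: "X \<in> subspaces E" "cyclic \<rho> X"
    have "\<rho> (e ` X) \<le> \<rho> (fv.span {l})"
      using e(2) by (intro rank_mono idempotent_image_mem(1)[OF e(1) X(1)] L) blast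
    moreover have "\<rho> (compl e ` X) \<le> \<rho> X + \<rho> (fv.span {l})"
    proof (rule rank_subadditive[OF idempotent_image_mem(2)[OF e(1) X(1)] X(1) L])
      fix z assume "z \<in> compl e ` X"
      then obtain x where x: "x \<in> X" "z = x + (- e x)" by auto
      moreover have "- e x \<in> fv.span {l}" using e(2) fv.span_neg by blast
      ultimately show "\<exists>a\<in>X. \<exists>b\<in>fv.span {l}. z = a + b" by blast
    qed
    ultimately show "\<rho> (e ` X) + \<rho> (compl e ` X) \<le> \<rho> X" using rank_l by simp
  qed
  then have "\<forall>x\<in>E. e x = x" using irreducible_projection[OF irr] e(3)[OF l_L] l(2) lE by metis
  then show ?thesis using e(2) subspacesD(2)[OF L] by (metis subsetI subset_antisym)
qed

text \<open>The image under \<open>e\<close> is a coloop, since every cyclic subspace lies in the complement \<open>Y\<close>.\<close>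
lemma irreducible_not_cyclic:
  assumes irr: "irreducible_qm (E, \<rho>)" and "\<not> cyclic \<rho> E"
  obtains x where "E = fv.span {x}" "x \<noteq> 0" "\<rho> E = 1"
proof -
  obtain Y where Y: "Y \<in> subspaces E" "Y \<noteq> E" "nullity \<rho> E \<le> nullity \<rho> Y"
    using assms(2) subspace_ground by (auto simp: cyclic_def not_less)
  have null: "nullity \<rho> Y = nullity \<rho> E"
    using nullity_mono[OF Y(1) ground_mem subspacesD(2)[OF Y(1)]] Y(3) by simp
  obtain x where x: "x \<in> E" "x \<notin> Y" using Y(2) subspacesD(2)[OF Y(1)] by blast
  have x0: "x \<noteq> 0" using x(2) fv.subspace_0[OF subspacesD(1)[OF Y(1)]] by blast
  note mem = span_singleton_mem[OF x(1)]
  obtain e where e: "idempotent_on E e" "\<And>z. e z \<in> fv.span {x}" "\<And>z. z \<in> fv.span {x} \<Longrightarrow> e z = z"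
    "\<And>z. z \<in> Y \<Longrightarrow> e z = 0"
    using exists_idempotent_along[OF mem subspacesD(1)[OF Y(1)]
      fv.span_singleton_Int[OF subspacesD(1)[OF Y(1)] x(2)]]
    by metis
  have "direct_sum_projection E \<rho> e"
  proof (rule direct_sum_projectionI[OF e(1)])
    fix X assume X: "X \<in> subspaces E" "cyclic \<rho> X"
    then have XY: "X \<subseteq> Y" using cyclic_subset_if_nullity_eq_ground[OF Y(1) null] by blast
    have "e ` X = {0}" "compl e ` X = X"
      using XY e(4) fv.subspace_0[OF subspacesD(1)[OF X(1)]] by (force simp: subset_iff)+
    then show "\<rho> (e ` X) + \<rho> (compl e ` X) \<le> \<rho> X" using rank_zero by simp
  qed
  moreover have "e x = x" using e(3) by (simp add: fv.span_base)
  ultimately have id: "\<forall>z\<in>E. e z = z" using irreducible_projection[OF irr] x(1) x0 by metis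
  then have E: "E = fv.span {x}" using e(2) subspacesD(2)[OF mem] by (metis subsetI subset_antisym)
  have "Y = {0}"
  proof
    show "Y \<subseteq> {0}" using id e(4) subspacesD(2)[OF Y(1)] by force
    show "{0} \<subseteq> Y" using fv.subspace_0[OF subspacesD(1)[OF Y(1)]] by simp
  qed
  then have "nullity \<rho> E = 0"
    using null nullity_add_rank[OF zero_mem] fv.dim_le_card[of "{0 :: nat \<Rightarrow> 'f}" "{}"] by simp
  then have "\<rho> E = 1" using nullity_add_rank[OF ground_mem] fv.dim_span_singleton[OF x0] E by simp
  then show ?thesis using that E x0 by blast
qed

end

lemma qm_equiv_span_singleton:
  assumes "qmatroid (fv.span {x}, \<rho>)" "qmatroid (fv.span {y}, \<tau>)" "x \<noteq> 0" "y \<noteq> 0"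
    and rank: "\<rho> (fv.span {x}) = \<tau> (fv.span {y})"
  shows "qm_equiv (fv.span {x}, \<rho>) (fv.span {y}, \<tau>)"
proof -
  interpret A: q_matroid "fv.span {x}" \<rho> using assms by unfold_locales
  interpret B: q_matroid "fv.span {y}" \<tau> using assms by unfold_locales
  have "fv.independent {x}" using assms(3) by simp
  then obtain \<alpha> where \<alpha>: "flinear \<alpha>" "\<alpha> x = y" using fvp.linear_independent_extend[of "{x}" "\<lambda>_. y"]
    by auto
  have image: "\<alpha> ` fv.span {x} = fv.span {y}" using fvp.linear_span_image[OF \<alpha>(1), of "{x}"] \<alpha>(2)
    by simp
  have "inj_on \<alpha> (fv.span {x})"
    unfolding fvp.linear_inj_on_iff_eq_0[OF \<alpha>(1) A.subspace_ground]
    using assms(4) \<alpha>(2) by (auto simp: fv.span_singleton fvp.linear_scale[OF \<alpha>(1)])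
  moreover have "\<tau> (\<alpha> ` V) = \<rho> V" if "V \<in> subspaces (fv.span {x})" for V
  proof (cases "V = {0}")
    case True
    then show ?thesis using A.rank_zero B.rank_zero fvp.linear_0[OF \<alpha>(1)] by simp
  next
    case False
    then have "V = fv.span {x}" using that fv.subspace_of_span_singleton[of V x]
      by (simp add: subspaces_def)
    then show ?thesis using image rank by simp
  qed
  ultimately have "qm_iso \<alpha> (fv.span {x}, \<rho>) (fv.span {y}, \<tau>)"
    using \<alpha>(1) image by (simp add: qm_iso_def bij_betw_def)
  then show ?thesis by (rule qm_equiv_if_iso)
qed

section \<open>Decompositions into several summands\<close>

locale projection_family =
  fixes E :: "(nat \<Rightarrow> 'f::field) set" and I :: "'i set" and p :: "'i \<Rightarrow> (nat \<Rightarrow> 'f) \<Rightarrow> (nat \<Rightarrow> 'f)"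
  assumes finite_index: "finite I"
    and linear: "i \<in> I \<Longrightarrow> flinear (p i)"
    and closed: "i \<in> I \<Longrightarrow> x \<in> E \<Longrightarrow> p i x \<in> E"
    and orthogonal: "i \<in> I \<Longrightarrow> j \<in> I \<Longrightarrow> x \<in> E \<Longrightarrow> p i (p j x) = (if i = j then p i x else 0)"
    and sum_id: "x \<in> E \<Longrightarrow> (\<Sum>i\<in>I. p i x) = x"
begin

abbreviation summand :: "'i \<Rightarrow> (nat \<Rightarrow> 'f) set" where
  "summand i \<equiv> p i ` E"

lemma summand_fixed: "i \<in> I \<Longrightarrow> x \<in> summand i \<Longrightarrow> p i x = x"
  using orthogonal[of i i] by auto

text \<open>Rank-nullity for one \<open>p a\<close> at a time, restricted to the vectors killed by the previous ones.\<close>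
lemma dim_eq_sum:
  assumes V: "fv.subspace V" "V \<subseteq> E" "fv.fin_dim V" and inv: "\<And>i x. i \<in> I \<Longrightarrow> x \<in> V \<Longrightarrow> p i x \<in> V"
  shows "fv.dim V = (\<Sum>i\<in>I. fv.dim (p i ` V))"
proof -
  let ?K = "\<lambda>J. {x \<in> V. \<forall>j\<in>J. p j x = 0}"
  have "fv.dim V = (\<Sum>i\<in>J. fv.dim (p i ` V)) + fv.dim (?K J)" if "J \<subseteq> I" for J
    using finite_subset[OF that finite_index] that
  proof (induction J rule: finite_induct)
    case (insert a J)
    have a: "a \<in> I" and J: "\<And>j. j \<in> J \<Longrightarrow> j \<in> I \<and> j \<noteq> a" using insert by auto
    have K: "fv.subspace (?K J)"
      using V(1) J
      by (auto simp: fv.subspace_def fvp.linear_0 fvp.linear_add fvp.linear_scale linear)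
    have "p a x \<in> ?K J" "p a (p a x) = p a x" if "x \<in> V" for x
      using that V(2) J inv a orthogonal by auto
    then have "p a ` V \<subseteq> p a ` ?K J" by (metis (no_types, lifting) image_subsetI imageI)
    then have image: "p a ` ?K J = p a ` V" by blast
    have kernel: "{x \<in> ?K J. p a x = 0} = ?K (insert a J)" by auto
    have "fv.dim (p a ` V) + fv.dim (?K (insert a J)) = fv.dim (?K J)"
      using fvp.dim_image_plus_dim_kernel[OF linear[OF a] K fv.fin_dim_subset[OF V(3)]]
      unfolding image kernel by blast
    then show ?case using insert by simp
  qed simp
  then have "fv.dim V = (\<Sum>i\<in>I. fv.dim (p i ` V)) + fv.dim (?K I)" by simp
  moreover have "?K I \<subseteq> {0}"
  proof
    fix x assume "x \<in> ?K I"
    then show "x \<in> {0}" using sum_id[of x] V(2) by auto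
  qed
  ultimately show ?thesis using fv.dim_le_card[of "?K I" "{}"] by simp
qed

end

text \<open>On the remaining subspaces the ranks are forced, as for \<^term>\<open>direct_sum_projection\<close>.\<close>
locale decomposition = q_matroid E \<rho> + projection_family E I p
  for E :: "(nat \<Rightarrow> 'f::field) set" and \<rho> and I :: "'i set" and p +
  assumes rank_sum: "X \<in> subspaces E \<Longrightarrow> cyclic \<rho> X \<Longrightarrow> \<rho> X = (\<Sum>i\<in>I. \<rho> (p i ` X))"
begin

lemma projection_image_mem:
  assumes "i \<in> I" "V \<in> subspaces E" shows "p i ` V \<in> subspaces E"
  using subspacesD(2)[OF assms(2)] closed[OF assms(1)]
  by (intro image_mem[OF linear[OF assms(1)] assms(2)]) blast

lemma summand_mem: "i \<in> I \<Longrightarrow> summand i \<in> subspaces E"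
  using projection_image_mem[OF _ ground_mem] .

lemma q_matroid_summand: "i \<in> I \<Longrightarrow> q_matroid (summand i) \<rho>"
  using q_matroid_restrict[OF summand_mem] .

lemma projection_cyclic:
  assumes i: "i \<in> I" and X: "X \<in> subspaces E" "cyclic \<rho> X"
  shows "cyclic \<rho> (p i ` X)"
proof (rule cyclic_image[OF X(1) finite_index linear _ _ _ i X(2)])
  show "p j ` X \<subseteq> E" if "j \<in> I" for j using subspacesD(2)[OF projection_image_mem[OF that X(1)]] .
  show "(\<Sum>i\<in>I. p i x) = x" if "x \<in> X" for x using sum_id subspacesD(2)[OF X(1)] that by blast
  show "(\<Sum>i\<in>I. \<rho> (p i ` X)) \<le> \<rho> X" using rank_sum[OF X] by simp
qed

lemma rank_projection_cyclic_le:
  assumes "i \<in> I" "X \<in> subspaces E" "cyclic \<rho> X"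
  shows "\<rho> (p i ` X) \<le> \<rho> X"
  unfolding rank_sum[OF assms(2,3)] using assms(1) finite_index by (intro member_le_sum) auto

lemma rank_projection_le_if_inj:
  assumes i: "i \<in> I" and V: "V \<in> subspaces E" and inj: "inj_on (p i) V"
  shows "\<rho> (p i ` V) \<le> \<rho> V"
proof -
  obtain X where X: "X \<in> subspaces V" "cyclic \<rho> X" "nullity \<rho> X = nullity \<rho> V"
    using exists_cyclic[OF V] .
  have XE: "X \<in> subspaces E" and XV: "X \<subseteq> V"
    using X(1) V by (auto simp: subspaces_def)
  have dim: "fv.dim (p i ` W) = fv.dim W" if "W \<in> subspaces E" "W \<subseteq> V" for W
    using fvp.dim_image_inj_on[OF linear[OF i] subspacesD(1)[OF that(1)]
      inj_on_subset[OF inj that(2)]] .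
  have "\<rho> (p i ` V) + fv.dim (p i ` X) \<le> \<rho> (p i ` X) + fv.dim (p i ` V)"
    using rank_add_dim_le[OF projection_image_mem[OF i XE] projection_image_mem[OF i V]] XV by blast
  then show ?thesis
    using rank_projection_cyclic_le[OF i XE X(2)] X(3) dim[OF XE XV] dim[OF V]
      nullity_add_rank[OF XE] nullity_add_rank[OF V] by simp
qed

lemma projection_loops:
  assumes i: "i \<in> I" and x: "x \<in> loops"
  shows "p i x \<in> loops"
proof (rule loops_if_rank_zero)
  have xE: "x \<in> E" "\<rho> (fv.span {x}) = 0" using x by (simp_all add: loops_def)
  note mem = span_singleton_mem[OF xE(1)]
  show "p i ` fv.span {x} \<in> subspaces E" using projection_image_mem[OF i mem] .
  show "\<rho> (p i ` fv.span {x}) = 0"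
    using rank_projection_cyclic_le[OF i mem cyclic_if_rank_zero[OF mem xE(2)]] xE(2) by simp
  show "p i x \<in> p i ` fv.span {x}" by (intro imageI fv.span_base) simp
qed

lemma direct_sum_projection_component:
  assumes j: "j \<in> I" shows "direct_sum_projection E \<rho> (p j)"
proof (rule direct_sum_projectionI)
  show "idempotent_on E (p j)" using linear closed orthogonal j by (auto simp: idempotent_on_def)
  fix X assume X: "X \<in> subspaces E" "cyclic \<rho> X"
  let ?q = "\<lambda>x. \<Sum>i\<in>I - {j}. p i x"
  have "x - p j x = ?q x" if "x \<in> X" for x
    using sum_id[of x] subspacesD(2)[OF X(1)] that sum.remove[OF finite_index j, of "\<lambda>i. p i x"]
    by (auto simp: algebra_simps)
  then have "compl (p j) ` X = ?q ` X" by (rule image_cong[OF refl])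
  moreover have "\<rho> (?q ` X) \<le> (\<Sum>i\<in>I - {j}. \<rho> (p i ` X))"
  proof (rule rank_image_sum_le[OF X(1)])
    show "p i ` X \<subseteq> E" if "i \<in> I - {j}" for i
      using subspacesD(2)[OF projection_image_mem[OF _ X(1)]] that by blast
  qed (use finite_index linear in auto)
  ultimately show "\<rho> (p j ` X) + \<rho> (compl (p j) ` X) \<le> \<rho> X"
    using rank_sum[OF X] sum.remove[OF finite_index j, of "\<lambda>i. \<rho> (p i ` X)"] by simp
qed

lemma irreducible_imp_identity_component:
  assumes irr: "irreducible_qm (E, \<rho>)" and nz: "E \<noteq> {0}"
  obtains j where "j \<in> I" "\<And>x. x \<in> E \<Longrightarrow> p j x = x"
proof -
  obtain x where x: "x \<in> E" "x \<noteq> 0" using nz fv.subspace_0[OF subspace_ground] by blast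
  then have "(\<Sum>j\<in>I. p j x) \<noteq> 0" using sum_id by simp
  then obtain j where "j \<in> I" "p j x \<noteq> 0" by (meson sum.neutral)
  then show ?thesis
    using that irreducible_projection[OF irr direct_sum_projection_component] x(1) by blast
qed

end

lemma (in q_matroid) decomposition_Suc:
  assumes e: "direct_sum_projection E \<rho> e" and p: "decomposition (compl e ` E) \<rho> {..<n} p"
  shows "decomposition E \<rho> {..<Suc n} (\<lambda>i. case i of 0 \<Rightarrow> e | Suc j \<Rightarrow> (\<lambda>x. p j (x - e x)))"
    (is "decomposition E \<rho> _ ?p")
proof -
  note idem = direct_sum_projection_idempotent[OF e]
  let ?E = "compl e ` E"
  interpret C: decomposition ?E \<rho> "{..<n}" p using p .
  have lin: "flinear e" "flinear (compl e)"
    using idempotent_onD(1)[OF idem] flinear_compl[OF idempotent_onD(1)[OF idem]] .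
  have C: "p j (x - e x) \<in> ?E" if "j < n" "x \<in> E" for j x using C.closed that by simp
  have e_p: "e (p j (x - e x)) = 0" if "j < n" "x \<in> E" for j x
    using C[OF that] idempotent_onD(4)[OF idem] by auto
  show ?thesis
  proof (intro decomposition.intro q_matroid_axioms projection_family.intro
    decomposition_axioms.intro)
    show "flinear (?p i)" if "i \<in> {..<Suc n}" for i
      using that lin(1) flinear_comp[OF lin(2) C.linear] by (cases i) simp_all
    show "?p i x \<in> E" if "i \<in> {..<Suc n}" "x \<in> E" for i x
      using that idempotent_onD(2)[OF idem]
        subsetD[OF subspacesD(2)[OF idempotent_ground_mem(2)[OF idem]] C]
      by (cases i) simp_all
    show "?p i (?p k x) = (if i = k then ?p i x else 0)"
      if "i \<in> {..<Suc n}" "k \<in> {..<Suc n}" "x \<in> E" for i k x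
      using that e_p C.orthogonal idempotent_onD(3)[OF idem] fvp.linear_0[OF C.linear]
      by (cases i; cases k) auto
    show "(\<Sum>i\<in>{..<Suc n}. ?p i x) = x" if "x \<in> E" for x
      unfolding sum.lessThan_Suc_shift using C.sum_id[of "x - e x"] that by simp
    fix X assume X: "X \<in> subspaces E" "cyclic \<rho> X"
    have "\<rho> (compl e ` X) = (\<Sum>j<n. \<rho> (p j ` compl e ` X))"
      using C.rank_sum[OF subspaces_image[OF lin(2) X(1)] projection_cyclic_image(2)[OF e X]] .
    then show "\<rho> X = (\<Sum>i\<in>{..<Suc n}. \<rho> (?p i ` X))"
      unfolding sum.lessThan_Suc_shift direct_sum_projection_rank_cyclic[OF e X] image_image by simp
  qed simp
qed

lemma (in q_matroid) decomposition_singleton: "decomposition E \<rho> {..<Suc 0} (\<lambda>i x. x)"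
  by (intro decomposition.intro q_matroid_axioms projection_family.intro decomposition_axioms.intro)
    (simp_all add: fv.linear_ident)

lemma exists_decomposition_dsum_list:
  assumes "Ms \<noteq> []" "\<forall>N\<in>set Ms. qmatroid N" "qmatroid (E, \<rho>)" "qm_equiv (E, \<rho>) (dsum_list Ms)"
  shows "\<exists>p. decomposition E \<rho> {..<length Ms} p \<and> (\<forall>i<length Ms. qm_equiv (p i ` E, \<rho>) (Ms ! i))"
  using assms
proof (induction Ms arbitrary: E rule: list_nonempty_induct)
  case (single N)
  interpret q_matroid E \<rho> using single by unfold_locales
  show ?case using decomposition_singleton single by (intro exI[of _ "\<lambda>_ x. x"]) simp
next
  case (cons N Ms)
  interpret q_matroid E \<rho> using cons by unfold_locales
  have qm: "qmatroid N" "qmatroid (dsum_list Ms)" using cons by (auto intro: qmatroid_dsum_list)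
  have "qm_equiv (E, \<rho>) (dsum N (dsum_list Ms))" using cons by (simp add: dsum_list_Cons)
  then obtain e where e: "direct_sum_projection E \<rho> e" "qm_equiv (e ` E, \<rho>) N"
    "qm_equiv (compl e ` E, \<rho>) (dsum_list Ms)"
    using qm_equiv_dsum_iff_projection[OF qm] by blast
  obtain p where p: "decomposition (compl e ` E) \<rho> {..<length Ms} p"
    "\<forall>i<length Ms. qm_equiv (p i ` compl e ` E, \<rho>) (Ms ! i)"
    using cons.IH[OF _ qmatroid_projection_images(2)[OF e(1)] e(3)] cons.prems(1) by auto
  let ?p = "\<lambda>i. case i of 0 \<Rightarrow> e | Suc j \<Rightarrow> (\<lambda>x. p j (x - e x))"
  have "qm_equiv (?p i ` E, \<rho>) ((N # Ms) ! i)" if "i < length (N # Ms)" for i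
    using that e(2) p(2) by (cases i) (simp_all add: image_image)
  then show ?case using decomposition_Suc[OF e(1) p(1)] by (intro exI[of _ ?p]) simp
qed

section \<open>Decompositions into irreducible summands\<close>

locale irreducible_decomposition = decomposition E \<rho> I p
  for E :: "(nat \<Rightarrow> 'f::field) set" and \<rho> and I :: "'i set" and p +
  assumes irreducible: "i \<in> I \<Longrightarrow> irreducible_qm (p i ` E, \<rho>)"
    and summand_nonzero: "i \<in> I \<Longrightarrow> p i ` E \<noteq> {0}"
begin

definition loop_summands :: "'i set" where
  "loop_summands = {i \<in> I. \<rho> (summand i) = 0}"

definition coloop_summands :: "'i set" where
  "coloop_summands = {i \<in> I. \<not> cyclic \<rho> (summand i)}"

definition core_summands :: "'i set" where
  "core_summands = {i \<in> I. cyclic \<rho> (summand i) \<and> \<rho> (summand i) \<noteq> 0}"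

lemma core_summandsD:
  assumes "i \<in> core_summands" shows "i \<in> I" "cyclic \<rho> (summand i)" "\<rho> (summand i) \<noteq> 0"
  using assms by (simp_all add: core_summands_def)

lemma summands_partition:
  "core_summands \<union> (loop_summands \<union> coloop_summands) = I"
  "core_summands \<inter> (loop_summands \<union> coloop_summands) = {}"
  "loop_summands \<inter> coloop_summands = {}"
  using cyclic_if_rank_zero[OF summand_mem]
  by (auto simp: core_summands_def loop_summands_def coloop_summands_def)

lemma finite_summands: "finite core_summands" "finite loop_summands" "finite coloop_summands"
  using finite_index by (auto simp: core_summands_def loop_summands_def coloop_summands_def)

lemma sum_summands:
  "(\<Sum>i\<in>I. f i) = (\<Sum>i\<in>core_summands. f i) + ((\<Sum>i\<in>loop_summands. f i) + (\<Sum>i\<in>coloop_summands. f i))"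
proof -
  have "(\<Sum>i\<in>I. f i) = (\<Sum>i\<in>core_summands \<union> (loop_summands \<union> coloop_summands). f i)"
    by (rule sum.cong[OF summands_partition(1)[symmetric] refl])
  then show ?thesis
    using finite_summands summands_partition(2,3) by (simp add: sum.union_disjoint)
qed

lemma summand_has_nonzero:
  assumes "i \<in> I" obtains x where "x \<in> summand i" "x \<noteq> 0"
  using summand_nonzero[OF assms] fv.subspace_0[OF subspacesD(1)[OF summand_mem[OF assms]]] by blast

lemma summand_eq_span_loop:
  assumes i: "i \<in> I" and x: "x \<in> summand i" "x \<in> loops" "x \<noteq> 0"
  shows "summand i = fv.span {x}"
proof -
  interpret R: q_matroid "summand i" \<rho> using q_matroid_summand[OF i] .
  have "x \<in> R.loops" using x unfolding R.loops_def loops_def by simp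
  then show ?thesis using R.irreducible_eq_span_loop irreducible[OF i] x(3) by blast
qed

lemma summand_loop_free:
  assumes "i \<in> I" "\<rho> (summand i) \<noteq> 0" "x \<in> summand i" "x \<in> loops"
  shows "x = 0"
proof (rule ccontr)
  assume "x \<noteq> 0"
  then have "summand i = fv.span {x}" using summand_eq_span_loop[OF assms(1,3,4)] by blast
  then show False using assms(2,4) by (simp add: loops_def)
qed

lemma loop_summand:
  assumes "i \<in> loop_summands"
  obtains x where "summand i = fv.span {x}" "x \<noteq> 0" "\<rho> (summand i) = 0"
proof -
  have i: "i \<in> I" "\<rho> (summand i) = 0" using assms by (simp_all add: loop_summands_def)
  obtain x where x: "x \<in> summand i" "x \<noteq> 0" using summand_has_nonzero[OF i(1)] .
  have "x \<in> loops" using loops_if_rank_zero[OF x(1) summand_mem[OF i(1)] i(2)] .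
  then show ?thesis using that summand_eq_span_loop[OF i(1) x(1)] x(2) i(2) by blast
qed

lemma coloop_summand:
  assumes "i \<in> coloop_summands"
  obtains x where "summand i = fv.span {x}" "x \<noteq> 0" "\<rho> (summand i) = 1"
proof -
  have i: "i \<in> I" "\<not> cyclic \<rho> (summand i)" using assms by (simp_all add: coloop_summands_def)
  interpret R: q_matroid "summand i" \<rho> using q_matroid_summand[OF i(1)] .
  show ?thesis using R.irreducible_not_cyclic[OF irreducible[OF i(1)] i(2)] that .
qed

lemma dim_loops: "fv.dim loops = card loop_summands"
proof -
  have loop: "fv.dim (p i ` loops) = 1" if i: "i \<in> loop_summands" for i
  proof -
    have "i \<in> I" using i by (simp add: loop_summands_def)
    obtain x where x: "summand i = fv.span {x}" "x \<noteq> 0" "\<rho> (summand i) = 0"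
      using loop_summand[OF i] .
    have "summand i \<subseteq> loops" using loops_if_rank_zero[OF _ summand_mem[OF \<open>i \<in> I\<close>] x(3)] by blast
    then have "p i ` summand i \<subseteq> p i ` loops" by (rule image_mono)
    moreover have "p i ` summand i = summand i"
      unfolding image_image using orthogonal[OF \<open>i \<in> I\<close> \<open>i \<in> I\<close>] by (intro image_cong refl) simp
    moreover have "p i ` loops \<subseteq> summand i" by (auto simp: loops_def)
    ultimately have "p i ` loops = summand i" by blast
    then show ?thesis using fv.dim_span_singleton[OF x(2)] x(1) by simp
  qed
  have other: "fv.dim (p i ` loops) = 0" if i: "i \<in> I" "\<rho> (summand i) \<noteq> 0" for i
  proof -
    have "p i x = 0" if "x \<in> loops" for x
    proof -
      have "x \<in> E" using that by (simp add: loops_def)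
      then show ?thesis using summand_loop_free[OF i _ projection_loops[OF i(1) that]] by blast
    qed
    then have "p i ` loops \<subseteq> fv.span {}" by auto
    then show ?thesis using fv.dim_le_card[of "p i ` loops" "{}"] by simp
  qed
  have "fv.dim (p i ` loops) = 0" if "i \<in> core_summands" for i
    using other core_summandsD[OF that] by blast
  moreover have "fv.dim (p i ` loops) = 0" if "i \<in> coloop_summands" for i
  proof (rule other)
    show "i \<in> I" using that by (simp add: coloop_summands_def)
    show "\<rho> (summand i) \<noteq> 0" by (rule coloop_summand[OF that]) simp
  qed
  ultimately show ?thesis
    using dim_eq_sum[OF subspacesD[OF loops_mem] projection_loops] loop by (simp add: sum_summands)
qed

lemma dim_ground:
  "fv.dim E = (\<Sum>i\<in>core_summands. fv.dim (summand i)) + (card loop_summands + card coloop_summands)"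
proof -
  have "fv.dim (summand i) = 1" if "i \<in> loop_summands \<union> coloop_summands" for i
    using that loop_summand[of i] coloop_summand[of i] fv.dim_span_singleton by (metis UnE)
  then show ?thesis
    using dim_eq_sum[OF subspacesD[OF ground_mem] closed] by (simp add: sum_summands)
qed

end

section \<open>Comparing two decompositions\<close>

locale decomposition_pair =
  q_matroid E \<rho> + P: decomposition E \<rho> I p + R: decomposition E \<rho> J r
  for E :: "(nat \<Rightarrow> 'f::field) set" and \<rho> and I :: "'i set" and p and J :: "'j set" and r
begin

lemma flinear_compress: "k \<in> I \<Longrightarrow> j \<in> J \<Longrightarrow> flinear (\<lambda>x. p k (r j x))"
  using flinear_comp[OF R.linear P.linear] .

lemma compress_sum_id:
  assumes i: "i \<in> I" and x: "x \<in> P.summand i"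
  shows "(\<Sum>j\<in>J. p i (r j x)) = x"
proof -
  have "x \<in> E" using x P.closed[OF i] by blast
  then have "(\<Sum>j\<in>J. p i (r j x)) = p i x"
    using fvp.linear_sum[OF P.linear[OF i], of "\<lambda>j. r j x" J] R.sum_id by simp
  then show ?thesis using P.summand_fixed[OF i x] by simp
qed

lemma rank_eq_sum_sum:
  assumes X: "X \<in> subspaces E" "cyclic \<rho> X"
  shows "\<rho> X = (\<Sum>j\<in>J. \<Sum>k\<in>I. \<rho> (p k ` r j ` X))"
  unfolding R.rank_sum[OF X]
  using R.projection_image_mem[OF _ X(1)] R.projection_cyclic[OF _ X]
  by (intro sum.cong refl P.rank_sum)

lemma compress_rank:
  assumes i: "i \<in> I" and X: "X \<in> subspaces (P.summand i)" "cyclic \<rho> X"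
  shows "\<rho> X = (\<Sum>j\<in>J. \<rho> (p i ` r j ` X))"
    and "\<And>j k. j \<in> J \<Longrightarrow> k \<in> I \<Longrightarrow> k \<noteq> i \<Longrightarrow> \<rho> (p k ` r j ` X) = 0"
proof -
  let ?rest = "\<Sum>j\<in>J. \<Sum>k\<in>I - {i}. \<rho> (p k ` r j ` X)"
  have XE: "X \<in> subspaces E" using subspaces_trans[OF X(1) subspacesD(2)[OF P.summand_mem[OF i]]] .
  have total: "\<rho> X = (\<Sum>j\<in>J. \<rho> (p i ` r j ` X)) + ?rest"
    unfolding rank_eq_sum_sum[OF XE X(2)] by (simp add: sum.remove[OF P.finite_index i] sum.distrib)
  have "x \<in> P.summand i" if "x \<in> X" for x using that X(1) by (auto simp: subspaces_def)
  then have "(\<lambda>x. \<Sum>j\<in>J. p i (r j x)) ` X = (\<lambda>x. x) ` X"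
    using compress_sum_id[OF i] by (intro image_cong) auto
  moreover have "\<rho> ((\<lambda>x. \<Sum>j\<in>J. p i (r j x)) ` X) \<le> (\<Sum>j\<in>J. \<rho> ((\<lambda>x. p i (r j x)) ` X))"
  proof (rule rank_image_sum_le[OF XE R.finite_index flinear_compress[OF i]])
    show "(\<lambda>x. p i (r j x)) ` X \<subseteq> E" if "j \<in> J" for j
      using P.closed[OF i] R.closed[OF that] subspacesD(2)[OF XE] by blast
  qed
  ultimately have rest: "?rest = 0" using total by (simp add: image_image)
  then show "\<rho> X = (\<Sum>j\<in>J. \<rho> (p i ` r j ` X))" using total by simp
  show "\<rho> (p k ` r j ` X) = 0" if "j \<in> J" "k \<in> I" "k \<noteq> i" for j k
    using rest that P.finite_index R.finite_index by simp
qed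

lemma compress_loops:
  assumes i: "i \<in> I" "cyclic \<rho> (P.summand i)" and jk: "j \<in> J" "k \<in> I" "k \<noteq> i"
    and x: "x \<in> P.summand i"
  shows "p k (r j x) \<in> loops"
proof (rule loops_if_rank_zero)
  note mem = P.summand_mem[OF i(1)]
  show "p k ` r j ` P.summand i \<in> subspaces E"
    using P.projection_image_mem[OF jk(2) R.projection_image_mem[OF jk(1) mem]] .
  have "P.summand i \<in> subspaces (P.summand i)" using subspacesD(1)[OF mem]
    by (simp add: subspaces_def)
  then show "\<rho> (p k ` r j ` P.summand i) = 0" using compress_rank(2)[OF i(1) _ i(2) jk] by blast
  show "p k (r j x) \<in> p k ` r j ` P.summand i" using x by blast
qed

text \<open>Loops are the only obstruction to the orthogonality of the compressed maps \<open>p i \<circ> r j\<close>.\<close>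
lemma compress_orthogonal:
  assumes i: "i \<in> I" "cyclic \<rho> (P.summand i)"
    and loop_free: "\<And>x. x \<in> P.summand i \<Longrightarrow> x \<in> loops \<Longrightarrow> x = 0"
    and j: "j \<in> J" and l: "l \<in> J" and x: "x \<in> P.summand i"
  shows "p i (r j (p i (r l x))) = (if j = l then p i (r j x) else 0)"
proof -
  have xE: "x \<in> E" using x P.closed[OF i(1)] by blast
  let ?y = "r l x"
  have yE: "?y \<in> E" using R.closed[OF l xE] .
  have "p i (r j (p k ?y)) = 0" if k: "k \<in> I - {i}" for k
  proof (rule loop_free)
    show "p i (r j (p k ?y)) \<in> P.summand i" using P.closed[of k] R.closed[OF j] yE k by blast
    have "p k ?y \<in> loops" using compress_loops[OF i l _ _ x] k by blast
    then show "p i (r j (p k ?y)) \<in> loops"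
      using P.projection_loops[OF i(1)] R.projection_loops[OF j] by blast
  qed
  then have "p i (r j (p i ?y)) = (\<Sum>k\<in>I. p i (r j (p k ?y)))"
    by (simp add: sum.remove[OF P.finite_index i(1)])
  also have "\<dots> = p i (r j ?y)"
    using fvp.linear_sum[OF flinear_compress[OF i(1) j], of "\<lambda>k. p k ?y" I] P.sum_id[OF yE] by simp
  finally show ?thesis using R.orthogonal[OF j l xE] fvp.linear_0[OF P.linear[OF i(1)]] by simp
qed

lemma decomposition_compress:
  assumes i: "i \<in> I" "cyclic \<rho> (P.summand i)"
    and loop_free: "\<And>x. x \<in> P.summand i \<Longrightarrow> x \<in> loops \<Longrightarrow> x = 0"
  shows "decomposition (P.summand i) \<rho> J (\<lambda>j x. p i (r j x))"
proof (intro decomposition.intro projection_family.intro decomposition_axioms.intro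
    P.q_matroid_summand[OF i(1)] R.finite_index flinear_compress[OF i(1)] compress_sum_id[OF i(1)])
  show "p i (r j x) \<in> P.summand i" if "j \<in> J" "x \<in> P.summand i" for j x
    using R.closed[OF that(1)] P.closed[OF i(1)] that(2) by blast
  show "p i (r j (p i (r l x))) = (if j = l then p i (r j x) else 0)"
    if "j \<in> J" "l \<in> J" "x \<in> P.summand i" for j l x
    using compress_orthogonal[OF i loop_free that] .
  show "\<rho> X = (\<Sum>j\<in>J. \<rho> ((\<lambda>x. p i (r j x)) ` X))"
    if "X \<in> subspaces (P.summand i)" "cyclic \<rho> X" for X
    using compress_rank(1)[OF i(1) that] by (simp add: image_image)
qed

lemma qm_equiv_summands:
  assumes i: "i \<in> I" and j: "j \<in> J"
    and pr: "\<And>x. x \<in> P.summand i \<Longrightarrow> p i (r j x) = x" and rp: "\<And>y. y \<in> R.summand j \<Longrightarrow> r j (p i y) = y"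
  shows "qm_equiv (P.summand i, \<rho>) (R.summand j, \<rho>)"
proof -
  have sub: "P.summand i \<subseteq> E" "R.summand j \<subseteq> E" using P.closed[OF i] R.closed[OF j] by blast+
  have inj: "inj_on (r j) (P.summand i)" "inj_on (p i) (R.summand j)"
    using pr rp by (auto intro: inj_on_inverseI)
  have "bij_betw (r j) (P.summand i) (R.summand j)"
    by (rule bij_betw_byWitness[where f' = "p i"]) (use pr rp sub in blast)+
  moreover have "\<rho> (r j ` V) = \<rho> V" if V: "V \<in> subspaces (P.summand i)" for V
  proof (rule antisym)
    have VE: "V \<in> subspaces E" and VP: "V \<subseteq> P.summand i"
      using V subspaces_trans[OF V sub(1)] by (simp_all add: subspaces_def)
    show "\<rho> (r j ` V) \<le> \<rho> V"
      using R.rank_projection_le_if_inj[OF j VE inj_on_subset[OF inj(1) VP]] .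
    have "r j ` V \<subseteq> R.summand j" using VP sub by blast
    then have "\<rho> (p i ` r j ` V) \<le> \<rho> (r j ` V)"
      using P.rank_projection_le_if_inj[OF i R.projection_image_mem[OF j VE]
        inj_on_subset[OF inj(2)]] by blast
    moreover have "(\<lambda>x. p i (r j x)) ` V = (\<lambda>x. x) ` V" using pr VP by (intro image_cong) auto
    ultimately show "\<rho> V \<le> \<rho> (r j ` V)" by (simp add: image_image)
  qed
  ultimately have "qm_iso (r j) (P.summand i, \<rho>) (R.summand j, \<rho>)"
    using R.linear[OF j] by (simp add: qm_iso_def)
  then show ?thesis by (rule qm_equiv_if_iso)
qed

end

locale irreducible_decomposition_pair =
  q_matroid E \<rho> + P: irreducible_decomposition E \<rho> I p + R: irreducible_decomposition E \<rho> J r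
  for E :: "(nat \<Rightarrow> 'f::field) set" and \<rho> and I :: "'i set" and p and J :: "'j set" and r
begin

sublocale decomposition_pair ..

lemma swap: "irreducible_decomposition_pair E \<rho> J r I p" ..

lemma core_summand_partner:
  assumes i: "i \<in> P.core_summands"
  shows "\<exists>j\<in>R.core_summands. \<forall>x\<in>P.summand i. p i (r j x) = x"
proof -
  note i' = P.core_summandsD[OF i]
  note loop_free = P.summand_loop_free[OF i'(1,3)] and mem = P.summand_mem[OF i'(1)]
  interpret S: decomposition "P.summand i" \<rho> J "\<lambda>j x. p i (r j x)"
    using decomposition_compress[OF i'(1,2) loop_free] .
  obtain j where j: "j \<in> J" "\<And>x. x \<in> P.summand i \<Longrightarrow> p i (r j x) = x"
    using S.irreducible_imp_identity_component[OF P.irreducible[OF i'(1)]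
      P.summand_nonzero[OF i'(1)]] by blast
  obtain x where x: "x \<in> P.summand i" "x \<noteq> 0" using P.summand_has_nonzero[OF i'(1)] .
  have rx: "r j x \<in> r j ` P.summand i" "r j ` P.summand i \<subseteq> R.summand j"
    using x(1) subspacesD(2)[OF mem] by blast+
  have rx0: "r j x \<noteq> 0" using j(2)[OF x(1)] x(2) fvp.linear_0[OF P.linear[OF i'(1)]] by auto
  have "\<rho> (R.summand j) \<noteq> 0"
  proof
    assume "\<rho> (R.summand j) = 0"
    then have "r j x \<in> loops" using loops_if_rank_zero[OF _ R.summand_mem[OF j(1)]] rx by blast
    then have "x \<in> loops" using P.projection_loops[OF i'(1)] j(2)[OF x(1)] by metis
    then show False using loop_free[OF x(1)] x(2) by simp
  qed
  moreover have "cyclic \<rho> (R.summand j)"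
  proof (rule ccontr)
    assume nc: "\<not> cyclic \<rho> (R.summand j)"
    then have "j \<in> R.coloop_summands" using j(1) by (simp add: R.coloop_summands_def)
    then obtain y where y: "R.summand j = fv.span {y}" using R.coloop_summand by blast
    have "r j ` P.summand i = R.summand j"
      unfolding y
    proof (rule fv.subspace_of_span_singleton)
      show "fv.subspace (r j ` P.summand i)"
        using subspacesD(1)[OF R.projection_image_mem[OF j(1) mem]] .
    qed (use rx rx0 y in auto)
    then show False using nc R.projection_cyclic[OF j(1) mem i'(2)] by simp
  qed
  ultimately have "j \<in> R.core_summands" using j(1) by (simp add: R.core_summands_def)
  then show ?thesis using j(2) by blast
qed

lemma core_summand_partner_unique:
  assumes i: "i \<in> P.core_summands" and j: "j \<in> J" and k: "k \<in> I"
    and pr: "\<And>x. x \<in> P.summand i \<Longrightarrow> p i (r j x) = x" and rp: "\<And>y. y \<in> R.summand j \<Longrightarrow> r j (p k y) = y"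
  shows "k = i"
proof (rule ccontr)
  assume ne: "k \<noteq> i"
  note i' = P.core_summandsD[OF i]
  obtain x where x: "x \<in> P.summand i" "x \<noteq> 0" using P.summand_has_nonzero[OF i'(1)] .
  have "r j x \<in> R.summand j" using x(1) subspacesD(2)[OF P.summand_mem[OF i'(1)]] by blast
  moreover have "r j (p k (r j x)) \<in> loops"
    using R.projection_loops[OF j compress_loops[OF i'(1,2) j k ne x(1)]] .
  ultimately have "r j x \<in> loops" using rp by simp
  then have "p i (r j x) \<in> loops" using P.projection_loops[OF i'(1)] by blast
  then show False using pr[OF x(1)] P.summand_loop_free[OF i'(1,3) x(1)] x(2) by simp
qed

lemma core_summands_bij:
  obtains \<sigma> where "bij_betw \<sigma> P.core_summands R.core_summands"
    "\<And>i. i \<in> P.core_summands \<Longrightarrow> qm_equiv (P.summand i, \<rho>) (R.summand (\<sigma> i), \<rho>)"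
proof -
  interpret swap: irreducible_decomposition_pair E \<rho> J r I p using swap .
  obtain \<sigma> where \<sigma>: "\<And>i. i \<in> P.core_summands \<Longrightarrow> \<sigma> i \<in> R.core_summands"
    "\<And>i x. i \<in> P.core_summands \<Longrightarrow> x \<in> P.summand i \<Longrightarrow> p i (r (\<sigma> i) x) = x"
    using core_summand_partner by metis
  obtain \<tau> where \<tau>: "\<And>j. j \<in> R.core_summands \<Longrightarrow> \<tau> j \<in> P.core_summands"
    "\<And>j y. j \<in> R.core_summands \<Longrightarrow> y \<in> R.summand j \<Longrightarrow> r j (p (\<tau> j) y) = y"
    using swap.core_summand_partner by metis
  note I = P.core_summandsD(1) and J = R.core_summandsD(1)
  have \<tau>\<sigma>: "\<tau> (\<sigma> i) = i" if i: "i \<in> P.core_summands" for i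
    using core_summand_partner_unique[OF i J[OF \<sigma>(1)[OF i]] I[OF \<tau>(1)[OF \<sigma>(1)[OF i]]] \<sigma>(2)[OF i]
      \<tau>(2)[OF \<sigma>(1)[OF i]]] .
  have \<sigma>\<tau>: "\<sigma> (\<tau> j) = j" if j: "j \<in> R.core_summands" for j
    using swap.core_summand_partner_unique[OF j I[OF \<tau>(1)[OF j]] J[OF \<sigma>(1)[OF \<tau>(1)[OF j]]]
      \<tau>(2)[OF j] \<sigma>(2)[OF \<tau>(1)[OF j]]] .
  have "bij_betw \<sigma> P.core_summands R.core_summands"
    by (rule bij_betw_byWitness[where f' = \<tau>]) (use \<sigma>(1) \<tau>(1) \<tau>\<sigma> \<sigma>\<tau> in blast)+
  moreover have "qm_equiv (P.summand i, \<rho>) (R.summand (\<sigma> i), \<rho>)" if i: "i \<in> P.core_summands" for i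
    using qm_equiv_summands[OF I[OF i] J[OF \<sigma>(1)[OF i]] \<sigma>(2)[OF i]] \<tau>(2)[OF \<sigma>(1)[OF i]] \<tau>\<sigma>[OF i]
    by simp
  ultimately show ?thesis using that by blast
qed

lemma card_loop_summands_eq: "card P.loop_summands = card R.loop_summands"
  using P.dim_loops R.dim_loops by simp

lemma card_coloop_summands_eq: "card P.coloop_summands = card R.coloop_summands"
proof -
  obtain \<sigma> where \<sigma>: "bij_betw \<sigma> P.core_summands R.core_summands"
    "\<And>i. i \<in> P.core_summands \<Longrightarrow> qm_equiv (P.summand i, \<rho>) (R.summand (\<sigma> i), \<rho>)"
    using core_summands_bij by blast
  have "(\<Sum>i\<in>P.core_summands. fv.dim (P.summand i)) = (\<Sum>i\<in>P.core_summands. fv.dim (R.summand (\<sigma> i)))"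
  proof (rule sum.cong[OF refl])
    fix i assume i: "i \<in> P.core_summands"
    then have "fv.subspace (P.summand i)" using P.summand_mem[OF P.core_summandsD(1)] subspacesD(1)
      by blast
    then show "fv.dim (P.summand i) = fv.dim (R.summand (\<sigma> i))" using qm_equiv_dim_eq[OF \<sigma>(2)[OF i]]
      by simp
  qed
  also have "\<dots> = (\<Sum>j\<in>R.core_summands. fv.dim (R.summand j))" by (rule sum.reindex_bij_betw[OF \<sigma>(1)])
  finally show ?thesis using P.dim_ground R.dim_ground card_loop_summands_eq by linarith
qed

lemma qm_equiv_line_summands:
  assumes "i \<in> P.loop_summands \<and> j \<in> R.loop_summands \<or>
    i \<in> P.coloop_summands \<and> j \<in> R.coloop_summands"
  shows "qm_equiv (P.summand i, \<rho>) (R.summand j, \<rho>)"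
proof -
  have "i \<in> I" "j \<in> J"
    using assms
    by (auto simp: P.loop_summands_def P.coloop_summands_def R.loop_summands_def
      R.coloop_summands_def)
  then have qm: "qmatroid (P.summand i, \<rho>)" "qmatroid (R.summand j, \<rho>)"
    using P.q_matroid_summand R.q_matroid_summand by (simp_all add: q_matroid_def)
  obtain x y where "P.summand i = fv.span {x}" "x \<noteq> 0" "R.summand j = fv.span {y}" "y \<noteq> 0"
    "\<rho> (P.summand i) = \<rho> (R.summand j)"
    using assms P.loop_summand R.loop_summand P.coloop_summand R.coloop_summand by metis
  then show ?thesis using qm_equiv_span_singleton qm by metis
qed

lemma summands_bij:
  obtains \<sigma> where "bij_betw \<sigma> I J" "\<And>i. i \<in> I \<Longrightarrow> qm_equiv (P.summand i, \<rho>) (R.summand (\<sigma> i), \<rho>)"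
proof -
  obtain \<sigma> where \<sigma>: "bij_betw \<sigma> P.core_summands R.core_summands"
    "\<And>i. i \<in> P.core_summands \<Longrightarrow> qm_equiv (P.summand i, \<rho>) (R.summand (\<sigma> i), \<rho>)"
    using core_summands_bij by blast
  obtain \<mu> where \<mu>: "bij_betw \<mu> P.loop_summands R.loop_summands"
    using finite_same_card_bij[OF P.finite_summands(2) R.finite_summands(2) card_loop_summands_eq]
    by blast
  obtain \<kappa> where \<kappa>: "bij_betw \<kappa> P.coloop_summands R.coloop_summands"
    using finite_same_card_bij[OF P.finite_summands(3) R.finite_summands(3) card_coloop_summands_eq]
    by blast
  let ?\<tau> = "\<lambda>i. if i \<in> P.loop_summands then \<mu> i else \<kappa> i"
  let ?\<pi> = "\<lambda>i. if i \<in> P.core_summands then \<sigma> i else ?\<tau> i"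
  have "bij_betw ?\<tau> (P.loop_summands \<union> P.coloop_summands) (R.loop_summands \<union> R.coloop_summands)"
    using bij_betw_disjoint_Un[OF \<mu> \<kappa> P.summands_partition(3) R.summands_partition(3)] .
  from bij_betw_disjoint_Un[OF \<sigma>(1) this P.summands_partition(2) R.summands_partition(2)]
  have "bij_betw ?\<pi> I J" unfolding P.summands_partition(1) R.summands_partition(1) .
  moreover have "qm_equiv (P.summand i, \<rho>) (R.summand (?\<pi> i), \<rho>)" if "i \<in> I" for i
  proof -
    have "i \<in> P.core_summands \<union> (P.loop_summands \<union> P.coloop_summands)"
      unfolding P.summands_partition(1) using that .
    then consider (core) "i \<in> P.core_summands" | (loop) "i \<in> P.loop_summands"
      | (coloop) "i \<in> P.coloop_summands" by blast
    then show ?thesis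
    proof cases
      case core
      then show ?thesis using \<sigma>(2) by simp
    next
      case loop
      then have "?\<pi> i = \<mu> i" using P.summands_partition(2) by auto
      then show ?thesis using qm_equiv_line_summands[of i "\<mu> i"] loop bij_betwE[OF \<mu>] by simp
    next
      case coloop
      then have "?\<pi> i = \<kappa> i" using P.summands_partition(2,3) by auto
      then show ?thesis using qm_equiv_line_summands[of i "\<kappa> i"] coloop bij_betwE[OF \<kappa>] by simp
    qed
  qed
  ultimately show ?thesis using that by blast
qed

end

section \<open>Uniqueness\<close>

lemma irreducible_decomposition_dsum_list:
  assumes M: "qmatroid (E, \<rho>)" and Ms: "Ms \<noteq> []" "\<forall>N\<in>set Ms. irreducible_qm N \<and> fst N \<noteq> {0}"
    and equiv: "qm_equiv (E, \<rho>) (dsum_list Ms)"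
  obtains p where "irreducible_decomposition E \<rho> {..<length Ms} p"
    "\<forall>i<length Ms. qm_equiv (p i ` E, \<rho>) (Ms ! i)"
proof -
  have "\<forall>N\<in>set Ms. qmatroid N" using Ms(2) by (simp add: irreducible_qm_def)
  then obtain p where p: "decomposition E \<rho> {..<length Ms} p"
    "\<forall>i<length Ms. qm_equiv (p i ` E, \<rho>) (Ms ! i)"
    using exists_decomposition_dsum_list[OF Ms(1) _ M equiv] by blast
  interpret decomposition E \<rho> "{..<length Ms}" p using p(1) .
  have "irreducible_qm (p i ` E, \<rho>) \<and> p i ` E \<noteq> {0}" if i: "i \<in> {..<length Ms}" for i
  proof
    interpret S: q_matroid "p i ` E" \<rho> using q_matroid_summand[OF i] .
    have N: "irreducible_qm (Ms ! i)" "fst (Ms ! i) \<noteq> {0}" using Ms(2) i by auto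
    have eq: "qm_equiv (p i ` E, \<rho>) (Ms ! i)" using p(2) i by simp
    show "irreducible_qm (p i ` E, \<rho>)" using qm_equiv_irreducible[OF eq S.qmatroid N(1)] .
    show "p i ` E \<noteq> {0}" using qm_equiv_zero_iff[OF eq] N(2) S.subspace_ground by simp
  qed
  then have "irreducible_decomposition E \<rho> {..<length Ms} p" by unfold_locales blast+
  then show ?thesis using that p(2) by blast
qed

lemma dsum_list_unique:
  assumes M: "qmatroid (E, \<rho>)"
    and Ms: "Ms \<noteq> []" "\<forall>N\<in>set Ms. irreducible_qm N \<and> fst N \<noteq> {0}" "qm_equiv (E, \<rho>) (dsum_list Ms)"
    and Ns: "Ns \<noteq> []" "\<forall>N\<in>set Ns. irreducible_qm N \<and> fst N \<noteq> {0}" "qm_equiv (E, \<rho>) (dsum_list Ns)"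
  shows "length Ns = length Ms \<and> (\<exists>\<sigma>. bij_betw \<sigma> {..<length Ms} {..<length Ms} \<and>
    (\<forall>i<length Ms. qm_equiv (Ms ! i) (Ns ! \<sigma> i)))"
proof -
  obtain p where p: "irreducible_decomposition E \<rho> {..<length Ms} p"
    "\<forall>i<length Ms. qm_equiv (p i ` E, \<rho>) (Ms ! i)"
    using irreducible_decomposition_dsum_list[OF M Ms] .
  obtain r where r: "irreducible_decomposition E \<rho> {..<length Ns} r"
    "\<forall>i<length Ns. qm_equiv (r i ` E, \<rho>) (Ns ! i)"
    using irreducible_decomposition_dsum_list[OF M Ns] .
  interpret P: irreducible_decomposition E \<rho> "{..<length Ms}" p using p(1) .
  interpret R: irreducible_decomposition E \<rho> "{..<length Ns}" r using r(1) .
  interpret irreducible_decomposition_pair E \<rho> "{..<length Ms}" p "{..<length Ns}" r ..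
  obtain \<sigma> where \<sigma>: "bij_betw \<sigma> {..<length Ms} {..<length Ns}"
    "\<And>i. i \<in> {..<length Ms} \<Longrightarrow> qm_equiv (p i ` E, \<rho>) (r (\<sigma> i) ` E, \<rho>)"
    using summands_bij by blast
  have "qm_equiv (Ms ! i) (Ns ! \<sigma> i)" if i: "i < length Ms" for i
  proof -
    have j: "\<sigma> i < length Ns" using bij_betwE[OF \<sigma>(1)] i by simp
    have sub: "fv.subspace (p i ` E)" "fv.subspace (r (\<sigma> i) ` E)"
      using P.subspacesD(1)[OF P.summand_mem] P.subspacesD(1)[OF R.summand_mem] i j by simp_all
    have "qmatroid (Ms ! i)" using Ms(2) i by (simp add: irreducible_qm_def)
    then have sub_Ms: "fv.subspace (fst (Ms ! i))"
      using q_matroid.subspace_ground[of "fst (Ms ! i)" "snd (Ms ! i)"] by (simp add: q_matroid_def)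
    have Ms_p: "qm_equiv (Ms ! i) (p i ` E, \<rho>)"
      using qm_equiv_sym[of "(p i ` E, \<rho>)" "Ms ! i"] p(2) i sub(1) by simp
    have "qm_equiv (p i ` E, \<rho>) (Ns ! \<sigma> i)"
      using qm_equiv_trans[OF \<sigma>(2), of i "Ns ! \<sigma> i"] r(2) i j sub by simp
    then show ?thesis using qm_equiv_trans[OF Ms_p _ sub_Ms] sub(1) by simp
  qed
  moreover have "length Ns = length Ms" using bij_betw_same_card[OF \<sigma>(1)] by simp
  ultimately show ?thesis using \<sigma>(1) by auto
qed

theorem theorem7p15:
  fixes M :: "('f::{field,finite}) qm"
  assumes "qmatroid M"
  shows "(\<exists>Ms. Ms \<noteq> [] \<and> (\<forall>N\<in>set Ms. irreducible_qm N) \<and> qm_equiv M (dsum_list Ms))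
    \<and> (\<forall>Ms Ns. Ms \<noteq> [] \<and> Ns \<noteq> [] \<and>
          (\<forall>N\<in>set Ms. irreducible_qm N \<and> fst N \<noteq> {0}) \<and>
          (\<forall>N\<in>set Ns. irreducible_qm N \<and> fst N \<noteq> {0}) \<and>
          qm_equiv M (dsum_list Ms) \<and> qm_equiv M (dsum_list Ns)
        \<longrightarrow> length Ns = length Ms \<and>
            (\<exists>\<sigma>. bij_betw \<sigma> {..<length Ms} {..<length Ms} \<and>
                 (\<forall>i<length Ms. qm_equiv (Ms ! i) (Ns ! \<sigma> i))))"
proof (intro conjI allI impI; (elim conjE)?)
  have M: "qmatroid (fst M, snd M)" using assms by simp
  show "\<exists>Ms. Ms \<noteq> [] \<and> (\<forall>N\<in>set Ms. irreducible_qm N) \<and> qm_equiv M (dsum_list Ms)"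
    using exists_irreducible_dsum_list[OF M] by simp
  fix Ms Ns :: "'f qm list"
  assume Ms: "Ms \<noteq> []" "\<forall>N\<in>set Ms. irreducible_qm N \<and> fst N \<noteq> {0}" "qm_equiv M (dsum_list Ms)"
    and Ns: "Ns \<noteq> []" "\<forall>N\<in>set Ns. irreducible_qm N \<and> fst N \<noteq> {0}" "qm_equiv M (dsum_list Ns)"
  show "length Ns = length Ms" and "\<exists>\<sigma>. bij_betw \<sigma> {..<length Ms} {..<length Ms} \<and>
      (\<forall>i<length Ms. qm_equiv (Ms ! i) (Ns ! \<sigma> i))"
    using dsum_list_unique[OF M Ms(1,2) _ Ns(1,2)] Ms(3) Ns(3) by simp_all
qed

end
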